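(* Let $\mu$ be a regular cardinal, let $L$ be a $\mu$-ary signature, and let $\kappa$ be a regular cardinal with $\mu + |L| \le \kappa$. Let $\mathcal{K}$ be an iso-full, replete and coherent subcategory of $\mathrm{Emb}(L)$ which is a $\kappa$-accessible category. Suppose that $\mathcal{K}$ is closed under $\mu$-directed colimits in $\mathrm{Emb}(L)$ and that the inclusion functor $\mathcal{K} \to \mathrm{Emb}(L)$ preserves $\kappa$-presentable objects. Define $M \le_{\mathcal{K}} N$ for $M, N \in \mathcal{K}$ iff $M \subseteq N$ and the inclusion map is a morphism of $\mathcal{K}$. Then $(\mathcal{K}, \le_{\mathcal{K}})$ is a $\mu$-AEC with $\mathrm{LS}(\mathcal{K}) \le \kappa^{<\mu}$.
   Context: For an infinite cardinal $\mu$, a $\mu$-ary language (signature) $L$ consists of function and relation symbols, each with an arity that is an ordinal $<\mu$; an $L$-structure $M$ has a universe $|M|$, interprets an $n$-ary function symbol as a function ${}^{n}|M| \to |M|$ and an $n$-ary relation symbol as a subset of ${}^{n}|M|$. $\mathrm{Emb}(L)$ is the category of $L$-structures with substructure embeddings (injective $L$-homomorphisms reflecting all relations) as morphisms. A subcategory $\mathcal{K}$ of $\mathrm{Emb}(L)$ is replete if it is closed under isomorphic copies of its objects, iso-full if it contains all isomorphisms between its objects, and coherent if whenever $f: A \to C$ and $g: B \to C$ are morphisms of $\mathcal{K}$ and $h: A \to B$ is a morphism of $\mathrm{Emb}(L)$ with $g \circ h = f$, then $h$ is a morphism of $\mathcal{K}$. For a regular cardinal $\kappa$: an object $M$ of a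 category $\mathcal{C}$ is $\kappa$-presentable if the hom-functor $\mathcal{C}(M,-)$ preserves $\kappa$-directed colimits; $\mathcal{C}$ is $\kappa$-accessible if it has all $\kappa$-directed colimits and has a set $\mathcal{A}$ of $\kappa$-presentable objects such that every object is a $\kappa$-directed colimit of objects of $\mathcal{A}$. A poset is $\mu$-directed if every subset of size $<\mu$ has an upper bound. A $\mu$-abstract class is a pair $(\mathcal{K}, \le_{\mathcal{K}})$ where $\mathcal{K}$ is a class of $L$-structures for a fixed $\mu$-ary language $L = L(\mathcal{K})$, $\le_{\mathcal{K}}$ is a reflexive and transitive relation on $\mathcal{K}$ such that $M \le_{\mathcal{K}} N$ implies $M$ is an $L$-substructure of $N$, and which respects isomorphisms. For $\mu$ regular, it is a $\mu$-AEC if: (Coherence) if $M_0, M_1, M_2 \in \mathcal{K}$, $M_0 \le_{\mathcal{K}} M_2$, $M_1 \le_{\mathcal{K}} M_2$ and $M_0 \subseteq M_1$, then $M_0 \le_{\mathcal{K}} M_1$; (Tarski–Vaught) if $\{M_i : i \in I\} \subseteq \mathcal{K}$ with $I$ $\mu$-directed and $i \le j \Rightarrow M_i \le_{\mathcal{K}} M_j$, then (a) $\bigcup_i M_i \in \mathcal{K}$ and $M_j \le_{\mathcal{K}} \bigcup_i M_i$ for all $j$, and (b) if $N \in \mathcal{K}$ with $M_i \le_{\mathcal{K}} N$ for all $i$, then $\bigcup_i M_i \le_{\mathcal{K}} N$; (Löwenheim–Skolem–Tarski) there is a cardinal $\lambda = \lambda^{<\mu} \ge |L(\mathcal{K})|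 + \mu$ such that for every $M \in \mathcal{K}$ and $A \subseteq |M|$ there is $N \le_{\mathcal{K}} M$ with $A \subseteq |N|$ and $|N| \le |A|^{<\mu} + \lambda$; $\mathrm{LS}(\mathcal{K})$ is the least such $\lambda$. *)

theory Defs
  imports Main "HOL-Library.FuncSet"
begin

unbundle cardinal_syntax

section \<open>Cardinals and the ambient universe\<close>

definition regular_cardinal :: "'c rel \<Rightarrow> bool" where
  "regular_cardinal r \<longleftrightarrow> Card_order r \<and> cinfinite r \<and> regularCard r"

text \<open>
  HOL has no proper classes, so ``set'' versus ``class'' is read relative to a universe: a cardinal
  \<open>theta\<close> on a type \<open>'u\<close>.  A collection is a set (is small) if it has fewer than \<open>theta\<close> elements; structures have
  small universes contained in \<open>'u\<close>, and diagrams are indexed by small posets on \<open>'u\<close>.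
  Any strongly inaccessible \<open>theta\<close> above \<open>kappa\<close> (a Grothendieck universe) qualifies, see
  \<open>universe_if_inaccessible\<close>.  The definition asks for less than inaccessibility because existence of
  an inaccessible cardinal is not provable in HOL; for instance \<open>theta = (2^kappa)^+\<close> also qualifies.
\<close>

definition universe :: "'u rel \<Rightarrow> 'k rel \<Rightarrow> bool" where
  "universe theta kappa \<longleftrightarrow>
     regular_cardinal theta \<and> kappa <o theta \<and>
     (\<forall>A :: 'u set. |A| <o theta \<longrightarrow> |{X. X \<subseteq> A \<and> |X| <o kappa}| <o theta)"

lemma universe_if_inaccessible:
  fixes theta :: "'u rel" and kappa :: "'k rel"
  assumes "regular_cardinal theta" and "kappa <o theta"
    and strong_limit: "\<And>A :: 'u set. |A| <o theta \<Longrightarrow> |Pow A| <o theta"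
  shows "universe theta kappa"
  unfolding universe_def
proof (intro conjI allI impI)
  fix A :: "'u set"
  assume "|A| <o theta"
  then have "|Pow A| <o theta" by (rule strong_limit)
  moreover have "|{X. X \<subseteq> A \<and> |X| <o kappa}| \<le>o |Pow A|"
    by (rule card_of_mono1) auto
  ultimately show "|{X. X \<subseteq> A \<and> |X| <o kappa}| <o theta"
    using ordLeq_ordLess_trans by blast
qed (use assms in auto)


text \<open>
  A cardinal \<open>mu\<close> is a well-order of minimal length in its cardinality, so the ordinals \<open>n < mu\<close>
  correspond exactly to the elements \<open>n \<in> Field mu\<close>, the ordinal \<open>n\<close> being the set \<open>underS mu n\<close> of
  its predecessors.  \<open>tuples mu n A\<close> is the set of functions from \<open>n\<close> to \<open>A\<close>.
\<close>

definition tuples :: "'b rel \<Rightarrow> 'b \<Rightarrow> 'a set \<Rightarrow> ('b \<Rightarrow> 'a) set" where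
  "tuples mu n A = underS mu n \<rightarrow>\<^sub>E A"

text \<open>
  \<open>A^{<mu}\<close> as the cardinality of the set of sequences in \<open>A\<close> of length \<open>< mu\<close>.  For \<open>|A| \<ge> 2\<close> this
  equals the supremum of the \<open>|A|^n\<close>, \<open>n < mu\<close>; for \<open>|A| \<le> 1\<close> it is at most \<open>mu\<close>, which
  is immaterial below since it only occurs there added to some \<open>lam \<ge> mu\<close>.
\<close>

definition less_power :: "'a set \<Rightarrow> 'b rel \<Rightarrow> ('b \<times> ('b \<Rightarrow> 'a)) rel" where
  "less_power A mu = |SIGMA n : Field mu. tuples mu n A|"


section \<open>Categories, directed colimits, accessibility\<close>

record ('o, 'a) category =
  Obj :: "'o set"
  Hom :: "'o \<Rightarrow> 'o \<Rightarrow> 'a set"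
  Id :: "'o \<Rightarrow> 'a"
  Comp :: "'o \<Rightarrow> 'o \<Rightarrow> 'o \<Rightarrow> 'a \<Rightarrow> 'a \<Rightarrow> 'a"
    \<comment> \<open>\<open>Comp C X Y Z g f\<close> is \<open>g \<circ> f\<close> for \<open>f : X \<rightarrow> Y\<close> and \<open>g : Y \<rightarrow> Z\<close>\<close>

definition is_category :: "('o, 'a) category \<Rightarrow> bool" where
  "is_category C \<longleftrightarrow>
     (\<forall>X \<in> Obj C. Id C X \<in> Hom C X X) \<and>
     (\<forall>X \<in> Obj C. \<forall>Y \<in> Obj C. \<forall>Z \<in> Obj C. \<forall>f \<in> Hom C X Y. \<forall>g \<in> Hom C Y Z.
        Comp C X Y Z g f \<in> Hom C X Z) \<and>
     (\<forall>X \<in> Obj C. \<forall>Y \<in> Obj C. \<forall>f \<in> Hom C X Y.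
        Comp C X X Y f (Id C X) = f \<and> Comp C X Y Y (Id C Y) f = f) \<and>
     (\<forall>W \<in> Obj C. \<forall>X \<in> Obj C. \<forall>Y \<in> Obj C. \<forall>Z \<in> Obj C.
        \<forall>f \<in> Hom C W X. \<forall>g \<in> Hom C X Y. \<forall>h \<in> Hom C Y Z.
        Comp C W X Z (Comp C X Y Z h g) f = Comp C W Y Z h (Comp C W X Y g f))"

definition iso :: "('o, 'a) category \<Rightarrow> 'o \<Rightarrow> 'o \<Rightarrow> 'a \<Rightarrow> bool" where
  "iso C X Y f \<longleftrightarrow> f \<in> Hom C X Y \<and>
     (\<exists>g \<in> Hom C Y X. Comp C X Y X g f = Id C X \<and> Comp C Y X Y f g = Id C Y)"

definition subcategory :: "('o, 'a) category \<Rightarrow> ('o, 'a) category \<Rightarrow> bool" where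
  "subcategory K C \<longleftrightarrow>
     Obj K \<subseteq> Obj C \<and> Id K = Id C \<and> Comp K = Comp C \<and>
     (\<forall>X \<in> Obj K. \<forall>Y \<in> Obj K. Hom K X Y \<subseteq> Hom C X Y) \<and>
     (\<forall>X \<in> Obj K. Id C X \<in> Hom K X X) \<and>
     (\<forall>X \<in> Obj K. \<forall>Y \<in> Obj K. \<forall>Z \<in> Obj K. \<forall>f \<in> Hom K X Y. \<forall>g \<in> Hom K Y Z.
        Comp C X Y Z g f \<in> Hom K X Z)"

lemma subcategory_is_category:
  assumes "subcategory K C" and "is_category C"
  shows "is_category K"
  using assms unfolding subcategory_def is_category_def by (auto simp: subset_iff)

definition replete :: "('o, 'a) category \<Rightarrow> ('o, 'a) category \<Rightarrow> bool" where
  "replete K C \<longleftrightarrow> (\<forall>X \<in> Obj K. \<forall>Y \<in> Obj C. \<forall>f. iso C X Y f \<longrightarrow> Y \<in> Obj K)"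

definition iso_full :: "('o, 'a) category \<Rightarrow> ('o, 'a) category \<Rightarrow> bool" where
  "iso_full K C \<longleftrightarrow> (\<forall>X \<in> Obj K. \<forall>Y \<in> Obj K. \<forall>f. iso C X Y f \<longrightarrow> f \<in> Hom K X Y)"

definition coherent :: "('o, 'a) category \<Rightarrow> ('o, 'a) category \<Rightarrow> bool" where
  "coherent K C \<longleftrightarrow>
     (\<forall>X \<in> Obj K. \<forall>Y \<in> Obj K. \<forall>Z \<in> Obj K. \<forall>f \<in> Hom K X Z. \<forall>g \<in> Hom K Y Z. \<forall>h \<in> Hom C X Y.
        Comp C X Y Z g h = f \<longrightarrow> h \<in> Hom K X Y)"

definition directed_poset :: "'m rel \<Rightarrow> 'i set \<Rightarrow> 'i rel \<Rightarrow> bool" where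
  "directed_poset mu I r \<longleftrightarrow> partial_order_on I r \<and>
     (\<forall>X. X \<subseteq> I \<and> |X| <o mu \<longrightarrow> (\<exists>u \<in> I. \<forall>x \<in> X. (x, u) \<in> r))"

record ('i, 'o, 'a) diagram =
  Idx :: "'i set"
  Ord :: "'i rel"
  Ob :: "'i \<Rightarrow> 'o"
  Ar :: "'i \<Rightarrow> 'i \<Rightarrow> 'a"

definition is_diagram :: "('o, 'a) category \<Rightarrow> ('i, 'o, 'a) diagram \<Rightarrow> bool" where
  "is_diagram C D \<longleftrightarrow>
     partial_order_on (Idx D) (Ord D) \<and>
     (\<forall>i \<in> Idx D. Ob D i \<in> Obj C \<and> Ar D i i = Id C (Ob D i)) \<and>
     (\<forall>i j. (i, j) \<in> Ord D \<longrightarrow> Ar D i j \<in> Hom C (Ob D i) (Ob D j)) \<and>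
     (\<forall>i j k. (i, j) \<in> Ord D \<and> (j, k) \<in> Ord D \<longrightarrow>
        Ar D i k = Comp C (Ob D i) (Ob D j) (Ob D k) (Ar D j k) (Ar D i j))"

definition is_cocone ::
    "('o, 'a) category \<Rightarrow> ('i, 'o, 'a) diagram \<Rightarrow> 'o \<Rightarrow> ('i \<Rightarrow> 'a) \<Rightarrow> bool" where
  "is_cocone C D X c \<longleftrightarrow>
     X \<in> Obj C \<and> (\<forall>i \<in> Idx D. c i \<in> Hom C (Ob D i) X) \<and>
     (\<forall>i j. (i, j) \<in> Ord D \<longrightarrow> c i = Comp C (Ob D i) (Ob D j) X (c j) (Ar D i j))"

definition is_colimit ::
    "('o, 'a) category \<Rightarrow> ('i, 'o, 'a) diagram \<Rightarrow> 'o \<Rightarrow> ('i \<Rightarrow> 'a) \<Rightarrow> bool" where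
  "is_colimit C D X c \<longleftrightarrow>
     is_cocone C D X c \<and>
     (\<forall>Y d. is_cocone C D Y d \<longrightarrow>
        (\<exists>!h. h \<in> Hom C X Y \<and> (\<forall>i \<in> Idx D. Comp C (Ob D i) X Y h (c i) = d i)))"

text \<open>Small diagrams in \<open>C\<close> indexed by a \<open>mu\<close>-directed poset.\<close>

definition directed_diagram ::
    "'u rel \<Rightarrow> 'm rel \<Rightarrow> ('o, 'a) category \<Rightarrow> ('u, 'o, 'a) diagram \<Rightarrow> bool" where
  "directed_diagram theta mu C D \<longleftrightarrow>
     |Idx D| <o theta \<and> directed_poset mu (Idx D) (Ord D) \<and> is_diagram C D"

record ('o1, 'a1, 'o2, 'a2) functor_data =
  on_obj :: "'o1 \<Rightarrow> 'o2"
  on_arr :: "'o1 \<Rightarrow> 'o1 \<Rightarrow> 'a1 \<Rightarrow> 'a2"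

definition map_diagram ::
    "('o1, 'a1, 'o2, 'a2) functor_data \<Rightarrow> ('i, 'o1, 'a1) diagram \<Rightarrow> ('i, 'o2, 'a2) diagram" where
  "map_diagram F D =
     \<lparr>Idx = Idx D, Ord = Ord D, Ob = (\<lambda>i. on_obj F (Ob D i)),
      Ar = (\<lambda>i j. on_arr F (Ob D i) (Ob D j) (Ar D i j))\<rparr>"

definition preserves_directed_colimits ::
    "'u rel \<Rightarrow> 'm rel \<Rightarrow> ('o1, 'a1) category \<Rightarrow> ('o2, 'a2) category \<Rightarrow>
     ('o1, 'a1, 'o2, 'a2) functor_data \<Rightarrow> bool" where
  "preserves_directed_colimits theta kappa C C' F \<longleftrightarrow>
     (\<forall>(D :: ('u, 'o1, 'a1) diagram) X c.
        directed_diagram theta kappa C D \<and> is_colimit C D X c \<longrightarrow>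
        is_colimit C' (map_diagram F D) (on_obj F X) (\<lambda>i. on_arr F (Ob D i) X (c i)))"

text \<open>The category of sets of elements of \<open>'s\<close>, functions being extensional.  It contains all
  hom-sets of a category with arrows in \<open>'s\<close>.\<close>

definition Set_cat :: "('s set, 's \<Rightarrow> 's) category" where
  "Set_cat = \<lparr>Obj = UNIV, Hom = (\<lambda>X Y. X \<rightarrow>\<^sub>E Y), Id = (\<lambda>X. \<lambda>x\<in>X. x),
              Comp = (\<lambda>X Y Z g f. compose X g f)\<rparr>"

lemma is_category_Set_cat: "is_category Set_cat"
  unfolding is_category_def Set_cat_def
  by (auto simp: PiE_iff compose_def extensional_def fun_eq_iff)

definition hom_functor :: "('o, 'a) category \<Rightarrow> 'o \<Rightarrow> ('o, 'a, 'a set, 'a \<Rightarrow> 'a) functor_data" where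
  "hom_functor C M =
     \<lparr>on_obj = (\<lambda>Y. Hom C M Y), on_arr = (\<lambda>Y Z f. \<lambda>g\<in>Hom C M Y. Comp C M Y Z f g)\<rparr>"

definition presentable :: "'u rel \<Rightarrow> 'k rel \<Rightarrow> ('o, 'a) category \<Rightarrow> 'o \<Rightarrow> bool" where
  "presentable theta kappa C M \<longleftrightarrow>
     M \<in> Obj C \<and> preserves_directed_colimits theta kappa C Set_cat (hom_functor C M)"

definition accessible :: "'u rel \<Rightarrow> 'k rel \<Rightarrow> ('o, 'a) category \<Rightarrow> bool" where
  "accessible theta kappa C \<longleftrightarrow>
     is_category C \<and>
     (\<forall>D :: ('u, 'o, 'a) diagram. directed_diagram theta kappa C D \<longrightarrow> (\<exists>X c. is_colimit C D X c)) \<and>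
     (\<exists>\<A>. |\<A>| <o theta \<and> (\<forall>M \<in> \<A>. presentable theta kappa C M) \<and>
        (\<forall>X \<in> Obj C. \<exists>(D :: ('u, 'o, 'a) diagram) c.
           directed_diagram theta kappa C D \<and> Ob D ` Idx D \<subseteq> \<A> \<and> is_colimit C D X c))"

text \<open>
  Closure of a (not necessarily full) subcategory under directed colimits of the ambient category:
  a colimit in \<open>C\<close> of a diagram of \<open>K\<close> is a colimit in \<open>K\<close>, that is, the cocone lies in \<open>K\<close> and so
  does the morphism induced by any cocone of \<open>K\<close>.
\<close>

definition closed_under_directed_colimits ::
    "'u rel \<Rightarrow> 'm rel \<Rightarrow> ('o, 'a) category \<Rightarrow> ('o, 'a) category \<Rightarrow> bool" where
  "closed_under_directed_colimits theta mu K C \<longleftrightarrow>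
     (\<forall>(D :: ('u, 'o, 'a) diagram) X c.
        directed_diagram theta mu K D \<and> is_colimit C D X c \<longrightarrow> is_colimit K D X c)"


section \<open>Structures and embeddings\<close>

text \<open>Arities are elements of \<open>Field mu\<close>, that is, ordinals below \<open>mu\<close>.\<close>

record ('f, 'r, 'b) signature =
  Funs :: "'f set"
  Rels :: "'r set"
  fun_ar :: "'f \<Rightarrow> 'b"
  rel_ar :: "'r \<Rightarrow> 'b"

definition mu_ary :: "'b rel \<Rightarrow> ('f, 'r, 'b) signature \<Rightarrow> bool" where
  "mu_ary mu L \<longleftrightarrow> fun_ar L ` Funs L \<subseteq> Field mu \<and> rel_ar L ` Rels L \<subseteq> Field mu"

definition sig_card :: "('f, 'r, 'b) signature \<Rightarrow> ('f + 'r) rel" where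
  "sig_card L = |Funs L <+> Rels L|"

record ('f, 'r, 'b, 'u) struct =
  Univ :: "'u set"
  Fn :: "'f \<Rightarrow> ('b \<Rightarrow> 'u) \<Rightarrow> 'u"
  Rl :: "'r \<Rightarrow> ('b \<Rightarrow> 'u) set"

definition is_structure ::
    "'b rel \<Rightarrow> ('f, 'r, 'b) signature \<Rightarrow> ('f, 'r, 'b, 'u) struct \<Rightarrow> bool" where
  "is_structure mu L M \<longleftrightarrow>
     Fn M \<in> (\<Pi>\<^sub>E f \<in> Funs L. tuples mu (fun_ar L f) (Univ M) \<rightarrow>\<^sub>E Univ M) \<and>
     Rl M \<in> (\<Pi>\<^sub>E R \<in> Rels L. Pow (tuples mu (rel_ar L R) (Univ M)))"

definition is_embedding ::
    "'b rel \<Rightarrow> ('f, 'r, 'b) signature \<Rightarrow> ('f, 'r, 'b, 'u) struct \<Rightarrow> ('f, 'r, 'b, 'u) struct \<Rightarrow>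
     ('u \<Rightarrow> 'u) \<Rightarrow> bool" where
  "is_embedding mu L M N h \<longleftrightarrow>
     h \<in> Univ M \<rightarrow>\<^sub>E Univ N \<and> inj_on h (Univ M) \<and>
     (\<forall>f \<in> Funs L. \<forall>a \<in> tuples mu (fun_ar L f) (Univ M).
        h (Fn M f a) = Fn N f (compose (underS mu (fun_ar L f)) h a)) \<and>
     (\<forall>R \<in> Rels L. \<forall>a \<in> tuples mu (rel_ar L R) (Univ M).
        a \<in> Rl M R \<longleftrightarrow> compose (underS mu (rel_ar L R)) h a \<in> Rl N R)"

definition Emb ::
    "'u rel \<Rightarrow> 'b rel \<Rightarrow> ('f, 'r, 'b) signature \<Rightarrow> (('f, 'r, 'b, 'u) struct, 'u \<Rightarrow> 'u) category" where
  "Emb theta mu L =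
     \<lparr>Obj = {M. is_structure mu L M \<and> |Univ M| <o theta},
      Hom = (\<lambda>M N. {h. is_embedding mu L M N h}),
      Id = (\<lambda>M. \<lambda>x\<in>Univ M. x),
      Comp = (\<lambda>A B C g f. compose (Univ A) g f)\<rparr>"

lemma is_embedding_compose:
  assumes A: "is_structure mu L A"
    and f: "is_embedding mu L A B f" and g: "is_embedding mu L B C g"
  shows "is_embedding mu L A C (compose (Univ A) g f)"
proof -
  have fin: "f x \<in> Univ B" if "x \<in> Univ A" for x
    using f that by (auto simp: is_embedding_def)
  have tup: "compose (underS mu n) f a \<in> tuples mu n (Univ B)"
    and assoc: "compose (underS mu n) (compose (Univ A) g f) a =
      compose (underS mu n) g (compose (underS mu n) f a)"
    if "a \<in> tuples mu n (Univ A)" for n a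
    using that fin by (auto simp: tuples_def compose_def fun_eq_iff PiE_iff)
  have "compose (Univ A) g f \<in> Univ A \<rightarrow>\<^sub>E Univ C"
    using f g by (auto simp: is_embedding_def compose_def)
  moreover have "inj_on (compose (Univ A) g f) (Univ A)"
    using f g fin by (auto simp: is_embedding_def compose_def inj_on_def)
  moreover have "compose (Univ A) g f (Fn A s a) =
      Fn C s (compose (underS mu (fun_ar L s)) (compose (Univ A) g f) a)"
    if s: "s \<in> Funs L" and a: "a \<in> tuples mu (fun_ar L s) (Univ A)" for s a
  proof -
    have "Fn A s a \<in> Univ A"
      using A s a by (auto simp: is_structure_def PiE_iff Pi_iff)
    then show ?thesis
      using f g s a tup[OF a] assoc[OF a] by (simp add: is_embedding_def compose_eq)
  qed
  moreover have "a \<in> Rl A R \<longleftrightarrow>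
      compose (underS mu (rel_ar L R)) (compose (Univ A) g f) a \<in> Rl C R"
    if R: "R \<in> Rels L" and a: "a \<in> tuples mu (rel_ar L R) (Univ A)" for R a
    using f g R a tup[OF a] assoc[OF a] by (simp add: is_embedding_def)
  ultimately show ?thesis
    by (simp add: is_embedding_def)
qed

lemma is_embedding_id:
  assumes "is_structure mu L A"
  shows "is_embedding mu L A A (\<lambda>x\<in>Univ A. x)"
proof -
  have id: "compose (underS mu n) (\<lambda>x\<in>Univ A. x) a = a" if "a \<in> tuples mu n (Univ A)" for n a
    using that by (auto simp: tuples_def compose_def fun_eq_iff PiE_iff extensional_def)
  have "Fn A s a \<in> Univ A" if "s \<in> Funs L" "a \<in> tuples mu (fun_ar L s) (Univ A)" for s a
    using assms that by (auto simp: is_structure_def PiE_iff Pi_iff)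
  then show ?thesis
    by (simp add: is_embedding_def id inj_on_def)
qed

lemma is_category_Emb: "is_category (Emb theta mu L)"
  unfolding is_category_def Emb_def
  by (auto simp: is_embedding_id is_embedding_compose)
     (auto simp: is_embedding_def PiE_iff compose_def extensional_def fun_eq_iff)

definition is_substructure ::
    "'b rel \<Rightarrow> ('f, 'r, 'b) signature \<Rightarrow> ('f, 'r, 'b, 'u) struct \<Rightarrow> ('f, 'r, 'b, 'u) struct \<Rightarrow> bool"
  where
  "is_substructure mu L M N \<longleftrightarrow>
     Univ M \<subseteq> Univ N \<and> is_embedding mu L M N (\<lambda>x\<in>Univ M. x)"

definition is_isomorphism ::
    "'b rel \<Rightarrow> ('f, 'r, 'b) signature \<Rightarrow> ('f, 'r, 'b, 'u) struct \<Rightarrow> ('f, 'r, 'b, 'u) struct \<Rightarrow>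
     ('u \<Rightarrow> 'u) \<Rightarrow> bool" where
  "is_isomorphism mu L M N h \<longleftrightarrow> is_embedding mu L M N h \<and> h ` Univ M = Univ N"

text \<open>
  The union of a \<open>mu\<close>-directed system of substructures; by directedness any tuple of length \<open>< mu\<close>
  lies in some member, and the choice of that member does not matter.
\<close>

definition union_struct ::
    "'b rel \<Rightarrow> ('f, 'r, 'b) signature \<Rightarrow> 'i set \<Rightarrow> ('i \<Rightarrow> ('f, 'r, 'b, 'u) struct) \<Rightarrow>
     ('f, 'r, 'b, 'u) struct" where
  "union_struct mu L I M =
     \<lparr>Univ = (\<Union>i\<in>I. Univ (M i)),
      Fn = (\<lambda>f\<in>Funs L. \<lambda>a\<in>tuples mu (fun_ar L f) (\<Union>i\<in>I. Univ (M i)).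
              Fn (M (SOME i. i \<in> I \<and> a \<in> tuples mu (fun_ar L f) (Univ (M i)))) f a),
      Rl = (\<lambda>R\<in>Rels L. \<Union>i\<in>I. Rl (M i) R)\<rparr>"


section \<open>\<open>mu\<close>-abstract elementary classes\<close>

definition abstract_class ::
    "'u rel \<Rightarrow> 'b rel \<Rightarrow> ('f, 'r, 'b) signature \<Rightarrow> ('f, 'r, 'b, 'u) struct set \<Rightarrow>
     (('f, 'r, 'b, 'u) struct \<Rightarrow> ('f, 'r, 'b, 'u) struct \<Rightarrow> bool) \<Rightarrow> bool" where
  "abstract_class theta mu L \<K> le \<longleftrightarrow>
     mu_ary mu L \<and>
     (\<forall>M \<in> \<K>. is_structure mu L M \<and> |Univ M| <o theta) \<and>
     (\<forall>M N. le M N \<longrightarrow> M \<in> \<K> \<and> N \<in> \<K>) \<and>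
     (\<forall>M \<in> \<K>. le M M) \<and>
     (\<forall>M N P. le M N \<and> le N P \<longrightarrow> le M P) \<and>
     (\<forall>M N. le M N \<longrightarrow> is_substructure mu L M N) \<and>
     (\<forall>M N h. M \<in> \<K> \<and> is_structure mu L N \<and> is_isomorphism mu L M N h \<longrightarrow> N \<in> \<K>) \<and>
     (\<forall>M0 M1 N0 N1 h.
        le M0 M1 \<and> is_structure mu L N0 \<and> is_structure mu L N1 \<and> is_substructure mu L N0 N1 \<and>
        is_isomorphism mu L M1 N1 h \<and> is_isomorphism mu L M0 N0 (restrict h (Univ M0)) \<longrightarrow>
        le N0 N1)"

definition coherence_axiom ::
    "'b rel \<Rightarrow> ('f, 'r, 'b) signature \<Rightarrow> ('f, 'r, 'b, 'u) struct set \<Rightarrow>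
     (('f, 'r, 'b, 'u) struct \<Rightarrow> ('f, 'r, 'b, 'u) struct \<Rightarrow> bool) \<Rightarrow> bool" where
  "coherence_axiom mu L \<K> le \<longleftrightarrow>
     (\<forall>M0 \<in> \<K>. \<forall>M1 \<in> \<K>. \<forall>M2 \<in> \<K>.
        le M0 M2 \<and> le M1 M2 \<and> is_substructure mu L M0 M1 \<longrightarrow> le M0 M1)"

definition tarski_vaught_axiom ::
    "'u rel \<Rightarrow> 'b rel \<Rightarrow> ('f, 'r, 'b) signature \<Rightarrow> ('f, 'r, 'b, 'u) struct set \<Rightarrow>
     (('f, 'r, 'b, 'u) struct \<Rightarrow> ('f, 'r, 'b, 'u) struct \<Rightarrow> bool) \<Rightarrow> bool" where
  "tarski_vaught_axiom theta mu L \<K> le \<longleftrightarrow>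
     (\<forall>(I :: 'u set) r M.
        |I| <o theta \<and> directed_poset mu I r \<and> (\<forall>i \<in> I. M i \<in> \<K>) \<and>
        (\<forall>i j. (i, j) \<in> r \<longrightarrow> le (M i) (M j)) \<longrightarrow>
          union_struct mu L I M \<in> \<K> \<and>
          (\<forall>j \<in> I. le (M j) (union_struct mu L I M)) \<and>
          (\<forall>N \<in> \<K>. (\<forall>i \<in> I. le (M i) N) \<longrightarrow> le (union_struct mu L I M) N))"

text \<open>
  \<open>lam\<close> witnesses the Loewenheim-Skolem-Tarski axiom.  Being a cardinal rather than a proper class,
  \<open>lam\<close> has to be small; hence it can be taken on the type \<open>'u\<close>.
\<close>

definition LST_witness ::
    "'u rel \<Rightarrow> 'b rel \<Rightarrow> ('f, 'r, 'b) signature \<Rightarrow> ('f, 'r, 'b, 'u) struct set \<Rightarrow>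
     (('f, 'r, 'b, 'u) struct \<Rightarrow> ('f, 'r, 'b, 'u) struct \<Rightarrow> bool) \<Rightarrow> 'u rel \<Rightarrow> bool" where
  "LST_witness theta mu L \<K> le lam \<longleftrightarrow>
     Card_order lam \<and> lam <o theta \<and> less_power (Field lam) mu =o lam \<and>
     sig_card L +c mu \<le>o lam \<and>
     (\<forall>M \<in> \<K>. \<forall>A. A \<subseteq> Univ M \<longrightarrow>
        (\<exists>N. le N M \<and> A \<subseteq> Univ N \<and> |Univ N| \<le>o less_power A mu +c lam))"

definition mu_AEC ::
    "'u rel \<Rightarrow> 'b rel \<Rightarrow> ('f, 'r, 'b) signature \<Rightarrow> ('f, 'r, 'b, 'u) struct set \<Rightarrow>
     (('f, 'r, 'b, 'u) struct \<Rightarrow> ('f, 'r, 'b, 'u) struct \<Rightarrow> bool) \<Rightarrow> bool" where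
  "mu_AEC theta mu L \<K> le \<longleftrightarrow>
     regular_cardinal mu \<and> abstract_class theta mu L \<K> le \<and> coherence_axiom mu L \<K> le \<and>
     tarski_vaught_axiom theta mu L \<K> le \<and> (\<exists>lam. LST_witness theta mu L \<K> le lam)"

text \<open>The least witness, which is determined up to \<open>=o\<close>.\<close>

definition LS_number ::
    "'u rel \<Rightarrow> 'b rel \<Rightarrow> ('f, 'r, 'b) signature \<Rightarrow> ('f, 'r, 'b, 'u) struct set \<Rightarrow>
     (('f, 'r, 'b, 'u) struct \<Rightarrow> ('f, 'r, 'b, 'u) struct \<Rightarrow> bool) \<Rightarrow> 'u rel" where
  "LS_number theta mu L \<K> le =
     (SOME lam. LST_witness theta mu L \<K> le lam \<and>
        (\<forall>lam'. LST_witness theta mu L \<K> le lam' \<longrightarrow> lam \<le>o lam'))"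

definition sub_le ::
    "(('f, 'r, 'b, 'u) struct, 'u \<Rightarrow> 'u) category \<Rightarrow> 'b rel \<Rightarrow> ('f, 'r, 'b) signature \<Rightarrow>
     ('f, 'r, 'b, 'u) struct \<Rightarrow> ('f, 'r, 'b, 'u) struct \<Rightarrow> bool" where
  "sub_le K mu L M N \<longleftrightarrow>
     M \<in> Obj K \<and> N \<in> Obj K \<and> is_substructure mu L M N \<and> (\<lambda>x\<in>Univ M. x) \<in> Hom K M N"

end

theory Submission
  imports Defs "HOL.Hull"
begin

text \<open>
  A union of a \<open>mu\<close>-directed system of substructures is its colimit in \<open>Emb\<close>, so closure under
  colimits gives the Tarski-Vaught axiom.  A \<open>kappa\<close>-presentable structure in \<open>Emb\<close> has size at most
  \<open>kappa^{<mu}\<close>: it is the \<open>kappa\<close>-directed union of its substructures generated by fewer than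
  \<open>kappa\<close> elements, and its identity factors through one of them.  Hence every object \<open>M\<close> of the
  class is a \<open>kappa\<close>-directed union of members \<open>N i \<le> M\<close> of size at most \<open>kappa^{<mu}\<close>.  Given a
  subset \<open>A\<close> of \<open>M\<close>, choose an index for each of its elements and close the set of these indices
  under upper bounds of sets of size \<open>< mu\<close>.  The resulting \<open>mu\<close>-directed set of indices has size at
  most \<open>A^{<mu} + kappa^{<mu}\<close>, and the union of the corresponding \<open>N i\<close> is the required submodel.
\<close>

section \<open>Small subsets and closures\<close>

text \<open>All counting is done with \<open>small_subsets mu A\<close> instead of sequences: upper
  bounds in a \<open>mu\<close>-directed poset are taken of such sets, and for
  \<open>mu \<le>o |A|\<close> there are as many of them as members of \<open>A^{<mu}\<close>.
  Regularity of \<open>mu\<close> makes the operation idempotent, which is why closing off costs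
  nothing beyond \<open>A^{<mu} + kappa^{<mu}\<close>. Two degrees of directedness interact.
  Accessibility and presentability concern \<open>kappa\<close>-directed diagrams, but closing
  indices under bounds of sets of size \<open>< kappa\<close> would only give a bound in terms of
  \<open>A^{<kappa}\<close>. A \<open>mu\<close>-directed set of indices is cheaper, and its union
  stays in the class because closure is assumed for \<open>mu\<close>-directed colimits. The size of
  a presentable object of \<open>K\<close> is measured in \<open>Emb\<close>, since its generated
  substructures need not lie in \<open>K\<close>; this is where preservation of presentable objects
  enters. A colimit in \<open>K\<close> is not known to be a union, nor is one in
  \<open>Set_cat\<close> described explicitly. In both cases the part covered by the cocone receives
  a section of its inclusion, so it is everything (\<open>colimit_section\<close>).\<close>

definition small_subsets :: "'m rel \<Rightarrow> 'a set \<Rightarrow> 'a set set" where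
  "small_subsets mu A = {X. X \<subseteq> A \<and> |X| <o mu}"

text \<open>Regularity is mostly used in the form \<open>stable\<close>: a union of fewer than
  \<open>mu\<close> sets, each of size \<open>< mu\<close>, has size \<open>< mu\<close>.\<close>

lemma regular_cardinalD:
  assumes "regular_cardinal mu"
  shows "Card_order mu" "\<not> finite (Field mu)" "Cinfinite mu" "regularCard mu" "stable mu"
  using assms regularCard_stable by (auto simp: regular_cardinal_def cinfinite_def)

lemma small_image:
  assumes "|X| <o mu"
  shows "|f ` X| <o mu"
  using card_of_image assms by (rule ordLeq_ordLess_trans)

lemma small_finite:
  assumes "regular_cardinal mu" and "finite X"
  shows "|X| <o mu"
  using finite_ordLess_infinite[of "|X|" mu, OF card_of_Well_order] regular_cardinalD(1,2)[OF assms(1)]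
    assms(2)
  by (simp add: Field_card_of card_order_on_well_order_on[of "Field mu"])

lemma inj_on_imp_ordLeq:
  assumes "inj_on f A" and "f ` A \<subseteq> B"
  shows "|A| \<le>o |B|"
  using assms by (auto simp: card_of_ordLeq[symmetric])

lemma small_subsets_mono_card:
  assumes "|A| \<le>o |B|"
  shows "|small_subsets mu A| \<le>o |small_subsets mu B|"
proof -
  obtain f where f: "inj_on f A" "f ` A \<subseteq> B"
    using assms by (auto simp: card_of_ordLeq[symmetric])
  have "inj_on ((`) f) (small_subsets mu A)"
    by (intro inj_on_image inj_on_subset[OF f(1)]) (auto simp: small_subsets_def)
  moreover have "(`) f ` small_subsets mu A \<subseteq> small_subsets mu B"
    using f(2) by (auto simp: small_subsets_def small_image)
  ultimately show ?thesis
    by (rule inj_on_imp_ordLeq)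
qed

lemma card_le_small_subsets:
  assumes "regular_cardinal mu"
  shows "|A| \<le>o |small_subsets mu A|"
proof -
  have "inj_on (\<lambda>x. {x}) A" "(\<lambda>x. {x}) ` A \<subseteq> small_subsets mu A"
    by (auto simp: small_subsets_def small_finite[OF assms])
  then show ?thesis
    by (rule inj_on_imp_ordLeq)
qed

lemma less_power_mono_card:
  assumes "|A| \<le>o |B|"
  shows "less_power A mu \<le>o less_power B mu"
proof -
  obtain f where f: "inj_on f A" "f ` A \<subseteq> B"
    using assms by (auto simp: card_of_ordLeq[symmetric])
  let ?g = "\<lambda>(n, a). (n, compose (underS mu n) f a)"
  have "inj_on ?g (SIGMA n : Field mu. tuples mu n A)"
  proof (rule inj_onI, clarsimp)
    fix n a b assume *: "a \<in> tuples mu n A" "b \<in> tuples mu n A"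
      "compose (underS mu n) f a = compose (underS mu n) f b"
    show "a = b"
    proof
      fix x
      show "a x = b x"
        using *(1,2) f(1) fun_cong[OF *(3), of x]
        by (cases "x \<in> underS mu n")
          (auto simp: tuples_def compose_def PiE_iff extensional_def inj_on_def)
    qed
  qed
  moreover have "?g ` (SIGMA n : Field mu. tuples mu n A) \<subseteq> (SIGMA n : Field mu. tuples mu n B)"
    using f(2) by (force simp: tuples_def compose_def PiE_iff)
  ultimately show ?thesis
    unfolding less_power_def by (rule inj_on_imp_ordLeq)
qed

text \<open>Of two distinct elements the smaller lies in \<open>underS\<close> of the larger, but no
  element lies in its own \<open>underS\<close>.\<close>

lemma underS_inject:
  assumes "Card_order mu" "m \<in> Field mu" "n \<in> Field mu" "underS mu m = underS mu n"
  shows "m = n"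
proof (rule ccontr)
  assume "m \<noteq> n"
  moreover have "Total mu"
    using assms(1) by (simp add: card_order_on_def well_order_on_def linear_order_on_def)
  ultimately have "m \<in> underS mu n \<or> n \<in> underS mu m"
    using assms(2,3) by (auto simp: total_on_def underS_def)
  then show False
    using assms(4) by (auto simp: underS_def)
qed

text \<open>A short sequence \<open>s\<close> of small sets is coded by the small set of all \<open>(m, x)\<close> with
  \<open>x \<in> s m\<close>; the extra elements \<open>(m, None)\<close> record the length of \<open>s\<close>.\<close>

lemma less_power_small_subsets:
  assumes mu: "regular_cardinal mu" and A: "mu \<le>o |A|"
  shows "less_power (small_subsets mu A) mu \<le>o |small_subsets mu A|"
proof -
  note mu' = regular_cardinalD[OF mu]
  define B where "B = Field mu \<times> insert None (Some ` A)"
  let ?g = "\<lambda>(n, s). SIGMA m : underS mu n. insert None (Some ` s m)"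
  let ?S = "SIGMA n : Field mu. tuples mu n (small_subsets mu A)"
  have inf: "\<not> finite A"
    using A mu' cinfinite_mono[OF A] by (simp add: cinfinite_def Field_card_of)
  have "inj_on ?g ?S"
  proof (rule inj_onI, clarsimp)
    fix m s n t
    assume *: "m \<in> Field mu" "n \<in> Field mu" "s \<in> tuples mu m (small_subsets mu A)"
      "t \<in> tuples mu n (small_subsets mu A)"
      and eq: "(SIGMA i : underS mu m. insert None (Some ` s i)) =
        (SIGMA i : underS mu n. insert None (Some ` t i))"
    have "underS mu m = underS mu n"
      using arg_cong[OF eq, of Domain] by (simp add: Domain_fst fst_image_Sigma)
    then have mn: "m = n"
      using underS_inject[OF mu'(1) *(1,2)] by simp
    moreover have "s i = t i" for i
    proof (cases "i \<in> underS mu n")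
      case True
      have "s i = {x. (i, Some x) \<in> (SIGMA i : underS mu m. insert None (Some ` s i))}"
        using True mn by auto
      also have "\<dots> = t i"
        unfolding eq using True by auto
      finally show ?thesis .
    next
      case False
      then show ?thesis
        using * mn by (simp add: tuples_def PiE_iff extensional_def)
    qed
    ultimately show "m = n \<and> s = t"
      by auto
  qed
  moreover have "?g ` ?S \<subseteq> small_subsets mu B"
  proof clarsimp
    fix n s
    assume n: "n \<in> Field mu" and s: "s \<in> tuples mu n (small_subsets mu A)"
    have "|insert None (Some ` s i)| <o mu" if "i \<in> underS mu n" for i
    proof -
      have "|Some ` s i| <o mu"
        using s that by (intro small_image) (auto simp: tuples_def small_subsets_def PiE_iff)
      moreover have "|{None}| <o mu"
        by (simp add: small_finite[OF mu])
      ultimately show ?thesis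
        using Un_Cinfinite_bound_strict[of "{None}" mu "Some ` s i"] mu' by simp
    qed
    \<comment> \<open>Regularity of \<open>mu\<close> enters here: fewer than \<open>mu\<close>
      fibres, each of size \<open>< mu\<close>.\<close>
    then have "|SIGMA i : underS mu n. insert None (Some ` s i)| <o mu"
      by (intro stable_elim[OF mu'(5) card_of_underS[OF mu'(1) n]])
    moreover have "(SIGMA i : underS mu n. insert None (Some ` s i)) \<subseteq> B"
      using s by (auto simp: B_def tuples_def small_subsets_def underS_def Field_def PiE_iff)
    ultimately show "(SIGMA i : underS mu n. insert None (Some ` s i)) \<in> small_subsets mu B"
      by (simp add: small_subsets_def)
  qed
  ultimately have "less_power (small_subsets mu A) mu \<le>o |small_subsets mu B|"
    unfolding less_power_def by (rule inj_on_imp_ordLeq)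
  \<comment> \<open>\<open>B\<close> has size \<open>mu * (|A| + 1)\<close>, which the infinite set
    \<open>A\<close> absorbs because \<open>mu \<le>o |A|\<close>.\<close>
  moreover have "|small_subsets mu B| \<le>o |small_subsets mu A|"
  proof (rule small_subsets_mono_card)
    have "|Field mu| \<le>o |A|"
      using card_of_Field_ordIso[OF mu'(1)] A by (rule ordIso_ordLeq_trans)
    moreover have "|insert None (Some ` A)| \<le>o |A|"
    proof -
      have "|{None} \<union> Some ` A| \<le>o |A|"
        using inf card_of_image[of Some A] card_of_singl_ordLeq[OF infinite_imp_nonempty[OF inf]]
        by (intro Un_Cinfinite_bound)
          (simp_all add: cinfinite_def Field_card_of card_of_card_order_on)
      then show ?thesis by simp
    qed
    ultimately show "|B| \<le>o |A|"
      unfolding B_def using card_of_Times_ordLeq_infinite_Field[of "|A|"] inf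
      by (simp add: Field_card_of card_of_card_order_on)
  qed
  ultimately show ?thesis
    by (rule ordLeq_transitive)
qed

lemma less_power_le_small_subsets:
  assumes "regular_cardinal mu" and "mu \<le>o |A|"
  shows "less_power A mu \<le>o |small_subsets mu A|"
  using less_power_mono_card[OF card_le_small_subsets[OF assms(1)]] less_power_small_subsets[OF assms]
  by (rule ordLeq_transitive)

text \<open>A well-order shorter than \<open>mu\<close> is isomorphic to a proper initial segment of
  \<open>mu\<close>. So every set of size \<open>< mu\<close> is the range of a sequence of length
  \<open>< mu\<close>, and taking ranges is onto.\<close>

lemma small_subsets_le_less_power:
  assumes mu: "regular_cardinal mu"
  shows "|small_subsets mu A| \<le>o less_power A mu"
proof -
  note mu' = regular_cardinalD[OF mu]
  let ?S = "SIGMA n : Field mu. tuples mu n A"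
  have "small_subsets mu A \<subseteq> (\<lambda>(n, a). a ` underS mu n) ` ?S"
  proof
    fix X assume "X \<in> small_subsets mu A"
    then have X: "X \<subseteq> A" "|X| <o mu"
      by (auto simp: small_subsets_def)
    then obtain n where n: "n \<in> Field mu" "|X| =o Restr mu (underS mu n)"
      using ordLess_iff_ordIso_Restr[of mu "|X|"] mu'(1)
      by (auto simp: card_of_Well_order card_order_on_well_order_on)
    have "Field (Restr mu (underS mu n)) = underS mu n"
      using mu'(1) by (intro Refl_Field_Restr2)
        (auto simp: card_order_on_def well_order_on_def linear_order_on_def
          partial_order_on_def preorder_on_def underS_def Field_def)
    then have "|X| =o |underS mu n|"
      using card_of_cong[OF n(2)] by (simp add: Field_card_of)
    then obtain f where f: "bij_betw f (underS mu n) X"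
      using card_of_ordIso ordIso_symmetric by blast
    let ?a = "restrict f (underS mu n)"
    have "?a \<in> tuples mu n A"
      using f X by (auto simp: tuples_def bij_betw_def)
    moreover have "X = ?a ` underS mu n"
      using f by (auto simp: bij_betw_def)
    ultimately show "X \<in> (\<lambda>(n, a). a ` underS mu n) ` ?S"
      using n(1) by (intro image_eqI[of _ _ "(n, ?a)"]) simp_all
  qed
  then show ?thesis
    unfolding less_power_def by (rule surj_imp_ordLeq)
qed

text \<open>The nontrivial half of \<open>(A^{<mu})^{<mu} = A^{<mu}\<close>. It provides the sets
  \<open>C\<close> to which \<open>card_closed_op_hull\<close> is applied.\<close>

lemma small_subsets_idem:
  assumes "regular_cardinal mu" and "mu \<le>o |A|"
  shows "|small_subsets mu (small_subsets mu A)| \<le>o |small_subsets mu A|"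
  using small_subsets_le_less_power[OF assms(1)] less_power_small_subsets[OF assms]
  by (rule ordLeq_transitive)

text \<open>A subset of the disjoint sum is the pair of its two traces, and a product is bounded by
  the sum since \<open>mu \<le>o |B|\<close> makes the sum infinite. This produces the shape
  \<open>A^{<mu} + lam\<close> of the Loewenheim-Skolem-Tarski axiom.\<close>

lemma card_small_subsets_Plus:
  fixes A :: "'a set" and B :: "'b set" and mu :: "'m rel"
  assumes mu: "regular_cardinal mu" and B: "mu \<le>o |B|"
  shows "|small_subsets mu (A <+> B)| \<le>o |small_subsets mu A| +c |small_subsets mu B|"
proof -
  let ?r = "|small_subsets mu A| +c |small_subsets mu B|"
  let ?g = "\<lambda>X. (Inl -` X, Inr -` X)"
  have small: "|f -` X| <o mu" if "inj f" "|X| <o mu" for f :: "'d \<Rightarrow> 'e" and X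
    using that(2) inj_on_imp_ordLeq[of f "f -` X" X] inj_on_subset[OF that(1)]
    by (auto intro: ordLeq_ordLess_trans)
  have "inj_on ?g (small_subsets mu (A <+> B))"
  proof (rule inj_onI)
    fix X Y :: "('a + 'b) set"
    assume "?g X = ?g Y"
    then have "z \<in> X \<longleftrightarrow> z \<in> Y" for z
      by (cases z) (auto simp: set_eq_iff)
    then show "X = Y"
      by blast
  qed
  moreover have "?g ` small_subsets mu (A <+> B) \<subseteq> small_subsets mu A \<times> small_subsets mu B"
    by (auto simp: small_subsets_def small)
  ultimately have "|small_subsets mu (A <+> B)| \<le>o |small_subsets mu A \<times> small_subsets mu B|"
    by (rule inj_on_imp_ordLeq)
  moreover have "|small_subsets mu A \<times> small_subsets mu B| \<le>o ?r"
  proof (rule card_of_Times_ordLeq_infinite_Field)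
    have B': "|small_subsets mu B| \<le>o ?r"
      by (rule ordLeq_csum2) (rule card_of_Card_order)
    show "|small_subsets mu A| \<le>o ?r"
      by (rule ordLeq_csum1) (rule card_of_Card_order)
    show "|small_subsets mu B| \<le>o ?r"
      by (rule B')
    have "mu \<le>o ?r"
      using ordLeq_transitive[OF ordLeq_transitive[OF B card_le_small_subsets[OF mu]] B'] .
    then show "\<not> finite (Field ?r)"
      using cinfinite_mono regular_cardinalD(3)[OF mu] by (auto simp: cinfinite_def)
  qed (rule Card_order_csum)
  ultimately show ?thesis
    by (rule ordLeq_transitive)
qed

section \<open>Closing a set under an operation on its small subsets\<close>

text \<open>The operation is set-valued so that one notion serves two purposes: adjoining a chosen
  upper bound (a singleton) and adjoining all values of function symbols.\<close>

definition closed_op :: "'m rel \<Rightarrow> ('a set \<Rightarrow> 'a set) \<Rightarrow> 'a set \<Rightarrow> bool" where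
  "closed_op mu G J \<longleftrightarrow> (\<forall>Y. Y \<subseteq> J \<and> |Y| <o mu \<longrightarrow> G Y \<subseteq> J)"

lemma closed_op_hull: "closed_op mu G (closed_op mu G hull A)"
proof (rule hull_in)
  fix T assume T: "\<forall>J\<in>T. closed_op mu G J"
  show "closed_op mu G (\<Inter>T)"
    unfolding closed_op_def
  proof (intro allI impI Inter_greatest)
    fix Y J assume "Y \<subseteq> \<Inter>T \<and> |Y| <o mu" and "J \<in> T"
    then have "Y \<subseteq> J \<and> |Y| <o mu"
      by blast
    then show "G Y \<subseteq> J"
      using T \<open>J \<in> T\<close> by (simp add: closed_op_def)
  qed
qed

text \<open>The closure is exhausted after \<open>mu\<close> steps, since \<open>mu\<close> is regular.\<close>

lemma card_closed_op_hull:
  assumes mu: "regular_cardinal mu" and C: "|small_subsets mu C| \<le>o |C|" "mu \<le>o |C|"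
    and G: "\<And>Y. |Y| <o mu \<Longrightarrow> |G Y| \<le>o |C|" and A: "|A| \<le>o |C|"
  shows "|closed_op mu G hull A| \<le>o |C|"
proof -
  note mu' = regular_cardinalD[OF mu]
  have inf: "\<not> finite C"
    using mu' cinfinite_mono[OF C(2)] by (simp add: cinfinite_def Field_card_of)
  then have cinf: "Cinfinite |C|"
    by (simp add: cinfinite_def Field_card_of card_of_card_order_on)
  have muC: "|Field mu| \<le>o |C|"
    using card_of_Field_ordIso[OF mu'(1)] C(2) by (rule ordIso_ordLeq_trans)
  have wf: "wf (mu - Relation.Id)" and trans: "trans mu" and anti: "antisym mu"
    using card_order_on_well_order_on[OF mu'(1)]
    by (simp_all add: well_order_on_def linear_order_on_def partial_order_on_def preorder_on_def)
  define step where "step = (\<lambda>T. A \<union> (\<Union>Y\<in>small_subsets mu T. G Y))"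
  \<comment> \<open>Stage \<open>a\<close> consists of \<open>A\<close> and the values of
    \<open>G\<close> on all small subsets of the union of the earlier stages.\<close>
  define J where "J = wfrec (mu - Relation.Id) (\<lambda>f a. step (\<Union>b\<in>underS mu a. f b))"
  have J: "J a = step (\<Union>b\<in>underS mu a. J b)" for a
    unfolding J_def
    by (subst wfrec[OF wf], rule arg_cong[of _ _ step])
      (auto simp: cut_def underS_def)
  have step_mono: "step S \<subseteq> step T" if "S \<subseteq> T" for S T
    using that by (fastforce simp: step_def small_subsets_def)
  have chain: "relChain mu J"
    unfolding relChain_def
  proof (intro allI impI)
    fix a b assume ab: "(a, b) \<in> mu"
    have "underS mu a \<subseteq> underS mu b"
      using ab trans anti unfolding underS_def by (auto dest: transD antisymD)
    then show "J a \<subseteq> J b"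
      unfolding J[of a] J[of b] by (intro step_mono) blast
  qed
  have "|J a| \<le>o |C|" for a
  proof (induction a rule: wf_induct_rule[OF wf])
    case (1 a)
    have "|underS mu a| \<le>o |C|"
    proof -
      have "|underS mu a| \<le>o |Field mu|"
        by (rule card_of_mono1) (auto simp: underS_def Field_def)
      then show ?thesis
        using muC by (rule ordLeq_transitive)
    qed
    then have T: "|\<Union>b\<in>underS mu a. J b| \<le>o |C|"
      using 1 inf by (intro card_of_UNION_ordLeq_infinite) (auto simp: underS_def)
    \<comment> \<open>The earlier stages together fit into \<open>C\<close>, and \<open>C\<close>
      has no more small subsets than elements.\<close>
    then have "|small_subsets mu (\<Union>b\<in>underS mu a. J b)| \<le>o |C|"
      by (rule ordLeq_transitive[OF small_subsets_mono_card C(1)])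
    then have "|\<Union>Y\<in>small_subsets mu (\<Union>b\<in>underS mu a. J b). G Y| \<le>o |C|"
      using G inf by (intro card_of_UNION_ordLeq_infinite) (auto simp: small_subsets_def)
    then show ?case
      unfolding J[of a] step_def using A cinf by (intro Un_Cinfinite_bound)
  qed
  then have card: "|\<Union>a\<in>Field mu. J a| \<le>o |C|"
    using inf muC by (simp add: card_of_UNION_ordLeq_infinite)
  have "closed_op mu G (\<Union>a\<in>Field mu. J a)"
    unfolding closed_op_def
  proof (intro allI impI)
    fix Y assume Y: "Y \<subseteq> (\<Union>a\<in>Field mu. J a) \<and> |Y| <o mu"
    then obtain a where a: "a \<in> Field mu" "Y \<subseteq> J a"
      using regularCard_UNION[OF mu'(1,4) chain] by blast
    \<comment> \<open>Stage \<open>a\<close> contains \<open>Y\<close> but perhaps not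
      \<open>G Y\<close>, since a stage only looks at strictly earlier ones. A later stage exists
      because an infinite cardinal has no last element.\<close>
    obtain b where b: "b \<in> Field mu" "a \<in> underS mu b"
      using infinite_Card_order_limit[OF mu'(1,2) a(1)] by (auto simp: underS_def)
    have "Y \<in> small_subsets mu (\<Union>b\<in>underS mu b. J b)"
      using Y a b by (auto simp: small_subsets_def)
    then have "G Y \<subseteq> J b"
      unfolding J[of b] step_def by blast
    then show "G Y \<subseteq> (\<Union>a\<in>Field mu. J a)"
      using b by blast
  qed
  moreover have "A \<subseteq> (\<Union>a\<in>Field mu. J a)"
  proof -
    obtain a where "a \<in> Field mu"
      using mu'(2) by fastforce
    moreover have "A \<subseteq> J a"
      unfolding J[of a] step_def by blast
    ultimately show ?thesis by blast
  qed
  ultimately have "closed_op mu G hull A \<subseteq> (\<Union>a\<in>Field mu. J a)"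
    by (intro hull_minimal)
  from ordLeq_transitive[OF card_of_mono1[OF this] card] show ?thesis .
qed


section \<open>Directed unions of structures\<close>

lemma tuples_mono: "S \<subseteq> T \<Longrightarrow> tuples mu n S \<subseteq> tuples mu n T"
  unfolding tuples_def by (rule PiE_mono)

lemma compose_restrict_tuples:
  assumes "a \<in> tuples mu n S"
  shows "compose (underS mu n) (restrict h S) a = compose (underS mu n) h a"
  using assms by (auto simp: tuples_def compose_def fun_eq_iff PiE_iff)

lemma compose_id_tuples:
  assumes "a \<in> tuples mu n S"
  shows "compose (underS mu n) (\<lambda>x. x) a = a"
  using assms by (auto simp: tuples_def compose_def fun_eq_iff PiE_iff extensional_def)

lemma compose_tuples:
  assumes "a \<in> tuples mu n S" and "h ` S \<subseteq> T"
  shows "compose (underS mu n) h a \<in> tuples mu n T"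
  using assms by (auto simp: tuples_def compose_def PiE_iff)

lemma Fn_in_Univ:
  assumes "is_structure mu L M" "f \<in> Funs L" "a \<in> tuples mu (fun_ar L f) (Univ M)"
  shows "Fn M f a \<in> Univ M"
  using assms by (auto simp: is_structure_def PiE_iff Pi_iff)

lemma Rl_subset_tuples:
  assumes "is_structure mu L M" "R \<in> Rels L"
  shows "Rl M R \<subseteq> tuples mu (rel_ar L R) (Univ M)"
  using assms by (auto simp: is_structure_def PiE_iff Pi_iff)

text \<open>Composing a tuple of \<open>M\<close> with the inclusion leaves it unchanged, so the
  embedding conditions reduce to plain agreement. That \<open>M\<close> is a structure ensures that
  the restricted identity fixes the values \<open>Fn M f a\<close>.\<close>

lemma is_substructure_iff:
  assumes "is_structure mu L M"
  shows "is_substructure mu L M N \<longleftrightarrow> Univ M \<subseteq> Univ N \<and>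
    (\<forall>f \<in> Funs L. \<forall>a \<in> tuples mu (fun_ar L f) (Univ M). Fn M f a = Fn N f a) \<and>
    (\<forall>R \<in> Rels L. \<forall>a \<in> tuples mu (rel_ar L R) (Univ M). a \<in> Rl M R \<longleftrightarrow> a \<in> Rl N R)"
proof -
  have "compose (underS mu n) (\<lambda>x\<in>Univ M. x) a = a" if "a \<in> tuples mu n (Univ M)" for n a
    by (simp only: compose_restrict_tuples[OF that] compose_id_tuples[OF that])
  then show ?thesis
    by (auto simp: is_substructure_def is_embedding_def inj_on_def Fn_in_Univ[OF assms])
qed

lemma is_substructure_cancel:
  assumes M: "is_structure mu L M0" "is_structure mu L M1"
    and sub: "is_substructure mu L M0 N" "is_substructure mu L M1 N" and "Univ M0 \<subseteq> Univ M1"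
  shows "is_substructure mu L M0 M1"
  unfolding is_substructure_iff[OF M(1)]
proof (intro conjI ballI)
  fix f a assume f: "f \<in> Funs L" and a: "a \<in> tuples mu (fun_ar L f) (Univ M0)"
  have "a \<in> tuples mu (fun_ar L f) (Univ M1)"
    using subsetD[OF tuples_mono[OF assms(5)] a] .
  then show "Fn M0 f a = Fn M1 f a"
    using f a sub by (simp add: is_substructure_iff[OF M(1)] is_substructure_iff[OF M(2)])
next
  fix R a assume R: "R \<in> Rels L" and a: "a \<in> tuples mu (rel_ar L R) (Univ M0)"
  have "a \<in> tuples mu (rel_ar L R) (Univ M1)"
    using subsetD[OF tuples_mono[OF assms(5)] a] .
  then show "a \<in> Rl M0 R \<longleftrightarrow> a \<in> Rl M1 R"
    using R a sub by (simp add: is_substructure_iff[OF M(1)] is_substructure_iff[OF M(2)])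
qed (rule assms(5))

section \<open>Induced substructures, images and isomorphisms\<close>

definition closed_in :: "'b rel \<Rightarrow> ('f, 'r, 'b) signature \<Rightarrow> ('f, 'r, 'b, 'u) struct \<Rightarrow> 'u set \<Rightarrow> bool"
  where
  "closed_in mu L M S \<longleftrightarrow> S \<subseteq> Univ M \<and>
     (\<forall>f \<in> Funs L. \<forall>a \<in> tuples mu (fun_ar L f) S. Fn M f a \<in> S)"

definition sub_struct ::
    "'b rel \<Rightarrow> ('f, 'r, 'b) signature \<Rightarrow> ('f, 'r, 'b, 'u) struct \<Rightarrow> 'u set \<Rightarrow>
     ('f, 'r, 'b, 'u) struct" where
  "sub_struct mu L M S =
     \<lparr>Univ = S,
      Fn = (\<lambda>f\<in>Funs L. \<lambda>a\<in>tuples mu (fun_ar L f) S. Fn M f a),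
      Rl = (\<lambda>R\<in>Rels L. Rl M R \<inter> tuples mu (rel_ar L R) S)\<rparr>"

lemma Univ_sub_struct [simp]: "Univ (sub_struct mu L M S) = S"
  by (simp add: sub_struct_def)

lemma is_structure_sub_struct:
  assumes "closed_in mu L M S"
  shows "is_structure mu L (sub_struct mu L M S)"
  using assms by (auto simp: is_structure_def sub_struct_def closed_in_def)

lemma is_substructure_sub_struct:
  assumes "closed_in mu L M S"
  shows "is_substructure mu L (sub_struct mu L M S) M"
  unfolding is_substructure_iff[OF is_structure_sub_struct[OF assms]]
  using assms by (auto simp: sub_struct_def closed_in_def)

lemma closed_in_image:
  assumes A: "is_structure mu L A" and h: "is_embedding mu L A B h"
  shows "closed_in mu L B (h ` Univ A)"
  unfolding closed_in_def
proof (intro conjI ballI)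
  show "h ` Univ A \<subseteq> Univ B"
    using h by (auto simp: is_embedding_def)
  fix f b assume f: "f \<in> Funs L" and b: "b \<in> tuples mu (fun_ar L f) (h ` Univ A)"
  define a where "a = (\<lambda>x\<in>underS mu (fun_ar L f). inv_into (Univ A) h (b x))"
  have a: "a \<in> tuples mu (fun_ar L f) (Univ A)"
    using b by (auto simp: a_def tuples_def PiE_iff intro: inv_into_into)
  have "compose (underS mu (fun_ar L f)) h a = b"
    using b
    by (auto simp: a_def tuples_def PiE_iff extensional_def compose_def fun_eq_iff f_inv_into_f)
  then have "Fn B f b = h (Fn A f a)"
    using h f a by (simp add: is_embedding_def)
  then show "Fn B f b \<in> h ` Univ A"
    using Fn_in_Univ[OF A f a] by simp
qed

lemma is_isomorphism_image:
  assumes A: "is_structure mu L A" and h: "is_embedding mu L A B h"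
  shows "is_isomorphism mu L A (sub_struct mu L B (h ` Univ A)) h"
proof -
  have "compose (underS mu n) h a \<in> tuples mu n (h ` Univ A)" if "a \<in> tuples mu n (Univ A)" for n a
    using that by (rule compose_tuples) simp
  then show ?thesis
    using h by (auto simp: is_isomorphism_def is_embedding_def sub_struct_def PiE_iff)
qed

lemma is_isomorphism_inverse:
  assumes A: "is_structure mu L A" and B: "is_structure mu L B" and h: "is_isomorphism mu L A B h"
  obtains g where "is_isomorphism mu L B A g"
    "compose (Univ A) g h = (\<lambda>x\<in>Univ A. x)" "compose (Univ B) h g = (\<lambda>x\<in>Univ B. x)"
proof -
  have emb: "is_embedding mu L A B h" and im: "h ` Univ A = Univ B" and inj: "inj_on h (Univ A)"
    using h by (auto simp: is_isomorphism_def is_embedding_def)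
  let ?g = "restrict (inv_into (Univ A) h) (Univ B)"
  have g: "?g y \<in> Univ A" "h (?g y) = y" if "y \<in> Univ B" for y
    using that im by (auto intro: inv_into_into f_inv_into_f)
  have gh: "?g (h x) = x" if "x \<in> Univ A" for x
    using that im inj by auto
  have tup: "compose (underS mu n) ?g b \<in> tuples mu n (Univ A)"
    and comp: "compose (underS mu n) h (compose (underS mu n) ?g b) = b"
    if "b \<in> tuples mu n (Univ B)" for n b
    using that g by (auto simp: tuples_def compose_def fun_eq_iff PiE_iff extensional_def)
  have "is_embedding mu L B A ?g"
    unfolding is_embedding_def
  proof (intro conjI ballI)
    show "?g \<in> Univ B \<rightarrow>\<^sub>E Univ A"
      using g by (auto simp: PiE_iff)
    show "inj_on ?g (Univ B)"
      by (metis g(2) inj_onI)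
  next
    fix f b assume f: "f \<in> Funs L" and b: "b \<in> tuples mu (fun_ar L f) (Univ B)"
    let ?a = "compose (underS mu (fun_ar L f)) ?g b"
    have "h (Fn A f ?a) = Fn B f b"
      using emb f tup[OF b] comp[OF b] by (simp add: is_embedding_def)
    then show "?g (Fn B f b) = Fn A f ?a"
      using gh[OF Fn_in_Univ[OF A f tup[OF b]]] by simp
  next
    fix R b assume R: "R \<in> Rels L" and b: "b \<in> tuples mu (rel_ar L R) (Univ B)"
    then show "b \<in> Rl B R \<longleftrightarrow> compose (underS mu (rel_ar L R)) ?g b \<in> Rl A R"
      using emb tup[OF b] comp[OF b] by (simp add: is_embedding_def)
  qed
  moreover have "?g ` Univ B = Univ A"
  proof
    show "Univ A \<subseteq> ?g ` Univ B"
      using gh im by (metis image_eqI subsetI)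
  qed (use g in auto)
  moreover have "compose (Univ A) ?g h = (\<lambda>x\<in>Univ A. x)"
    using gh im by (auto simp: compose_def fun_eq_iff)
  moreover have "compose (Univ B) h ?g = (\<lambda>x\<in>Univ B. x)"
    using g by (auto simp: compose_def fun_eq_iff)
  ultimately show ?thesis
    using that[of ?g] by (simp only: is_isomorphism_def)
qed

lemma Emb_simps:
  "Obj (Emb theta mu L) = {M. is_structure mu L M \<and> |Univ M| <o theta}"
  "Hom (Emb theta mu L) M N = {h. is_embedding mu L M N h}"
  "Id (Emb theta mu L) M = (\<lambda>x\<in>Univ M. x)"
  "Comp (Emb theta mu L) M N P g f = compose (Univ M) g f"
  by (simp_all add: Emb_def)

text \<open>Embeddings are injective and reflect relations, so only surjectivity separates them from
  isomorphisms. The lemma turns repleteness and iso-fullness into statements about isomorphisms of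
  structures.\<close>

lemma iso_Emb_iff:
  assumes "M \<in> Obj (Emb theta mu L)" "N \<in> Obj (Emb theta mu L)"
  shows "iso (Emb theta mu L) M N h \<longleftrightarrow> is_isomorphism mu L M N h"
proof
  assume "iso (Emb theta mu L) M N h"
  then obtain g where h: "is_embedding mu L M N h" and g: "is_embedding mu L N M g"
    and hg: "compose (Univ N) h g = (\<lambda>x\<in>Univ N. x)"
    by (auto simp: iso_def Emb_simps)
  have "y \<in> h ` Univ M" if "y \<in> Univ N" for y
    using fun_cong[OF hg, of y] that g by (auto simp: compose_def is_embedding_def PiE_iff intro!: image_eqI[of y h "g y"])
  then show "is_isomorphism mu L M N h"
    using h by (auto simp: is_isomorphism_def is_embedding_def)
next
  assume h: "is_isomorphism mu L M N h"
  obtain g where "is_isomorphism mu L N M g"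
    "compose (Univ M) g h = (\<lambda>x\<in>Univ M. x)" "compose (Univ N) h g = (\<lambda>x\<in>Univ N. x)"
    using is_isomorphism_inverse[OF _ _ h] assms by (auto simp: Emb_simps)
  then show "iso (Emb theta mu L) M N h"
    using h by (auto simp: iso_def Emb_simps is_isomorphism_def)
qed

lemma compose_incl:
  assumes "S \<subseteq> T"
  shows "compose S h (\<lambda>x\<in>S. x) = restrict h S" "compose S (\<lambda>x\<in>T. x) (\<lambda>x\<in>S. x) = (\<lambda>x\<in>S. x)"
  using assms by (auto simp: compose_def fun_eq_iff)

text \<open>As \<open>mu\<close> is infinite, every finite set of indices has an upper bound; the
  bound of the empty set shows \<open>I \<noteq> {}\<close>.\<close>

lemma directed_posetD:
  assumes "directed_poset mu I r" and "regular_cardinal mu"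
  shows "r \<subseteq> I \<times> I" "I \<noteq> {}" "\<And>i. i \<in> I \<Longrightarrow> (i, i) \<in> r"
    "\<And>i j k. (i, j) \<in> r \<Longrightarrow> (j, k) \<in> r \<Longrightarrow> (i, k) \<in> r"
    "\<And>i j. i \<in> I \<Longrightarrow> j \<in> I \<Longrightarrow> \<exists>k\<in>I. (i, k) \<in> r \<and> (j, k) \<in> r"
proof -
  have bound: "\<exists>u\<in>I. \<forall>x\<in>X. (x, u) \<in> r" if "X \<subseteq> I" "finite X" for X
    using assms(1) small_finite[OF assms(2) that(2)] that(1) by (simp add: directed_poset_def)
  show "I \<noteq> {}"
    using bound[of "{}"] by blast
  show "\<exists>k\<in>I. (i, k) \<in> r \<and> (j, k) \<in> r" if "i \<in> I" "j \<in> I" for i j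
    using bound[of "{i, j}"] that by auto
  have po: "partial_order_on I r"
    using assms(1) by (simp add: directed_poset_def)
  show "r \<subseteq> I \<times> I"
    using po by (simp add: partial_order_on_def preorder_on_def)
  show "(i, i) \<in> r" if "i \<in> I" for i
    using po that by (simp add: partial_order_on_def preorder_on_def refl_on_def)
  have "trans r"
    using po by (simp add: partial_order_on_def preorder_on_def)
  then show "(i, k) \<in> r" if "(i, j) \<in> r" "(j, k) \<in> r" for i j k
    using that by (rule transD)
qed

lemma directed_poset_mono:
  assumes "directed_poset kappa I r" and "mu \<le>o kappa"
  shows "directed_poset mu I r"
  using assms(1) ordLess_ordLeq_trans[OF _ assms(2)] by (auto simp: directed_poset_def)

text \<open>Only substructure relations are required, so the locale covers generated substructures,
  which need not be in \<open>K\<close>, as well as systems inside \<open>K\<close>.\<close>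

locale directed_structures =
  fixes mu :: "'b rel" and L :: "('f, 'r, 'b) signature" and I :: "'i set" and r :: "'i rel"
    and M :: "'i \<Rightarrow> ('f, 'r, 'b, 'u) struct"
  assumes mu: "regular_cardinal mu" and ary: "mu_ary mu L" and dir: "directed_poset mu I r"
    and str: "\<And>i. i \<in> I \<Longrightarrow> is_structure mu L (M i)"
    and sub: "\<And>i j. (i, j) \<in> r \<Longrightarrow> is_substructure mu L (M i) (M j)"
begin

lemmas poset = directed_posetD[OF dir mu]

lemma Univ_mono: "(i, j) \<in> r \<Longrightarrow> Univ (M i) \<subseteq> Univ (M j)"
  using sub by (simp add: is_substructure_def)

lemma arity_in_Field: "f \<in> Funs L \<Longrightarrow> fun_ar L f \<in> Field mu" "R \<in> Rels L \<Longrightarrow> rel_ar L R \<in> Field mu"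
  using ary by (auto simp: mu_ary_def)

text \<open>A tuple has fewer than \<open>mu\<close> entries. Choosing a member for each entry gives
  a small set of indices, and the member at an upper bound of it contains the whole tuple.\<close>

lemma tuple_in_member:
  assumes n: "n \<in> Field mu" and a: "a \<in> tuples mu n (\<Union>i\<in>I. Univ (M i))"
  shows "\<exists>i\<in>I. a \<in> tuples mu n (Univ (M i))"
proof -
  have "\<forall>x\<in>underS mu n. \<exists>i\<in>I. a x \<in> Univ (M i)"
    using a by (auto simp: tuples_def)
  then obtain s where s: "\<And>x. x \<in> underS mu n \<Longrightarrow> s x \<in> I \<and> a x \<in> Univ (M (s x))"
    by metis
  have "|s ` underS mu n| <o mu"
    using card_of_underS[OF regular_cardinalD(1)[OF mu] n] by (rule small_image)
  moreover have "s ` underS mu n \<subseteq> I"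
    using s by blast
  ultimately obtain i where i: "i \<in> I" "\<And>x. x \<in> underS mu n \<Longrightarrow> (s x, i) \<in> r"
    using dir by (auto simp: directed_poset_def)
  have "a x \<in> Univ (M i)" if "x \<in> underS mu n" for x
    using s[OF that] Univ_mono[OF i(2)[OF that]] by blast
  then have "a \<in> tuples mu n (Univ (M i))"
    using a by (auto simp: tuples_def PiE_iff)
  with i(1) show ?thesis
    by blast
qed

text \<open>Both values are computed in a common upper bound. Hence the choice made in
  \<open>union_struct\<close> does not matter.\<close>

lemma Fn_agree:
  assumes "i \<in> I" "j \<in> I" and f: "f \<in> Funs L"
    and a: "a \<in> tuples mu (fun_ar L f) (Univ (M i))" "a \<in> tuples mu (fun_ar L f) (Univ (M j))"
  shows "Fn (M i) f a = Fn (M j) f a"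
proof -
  obtain k where k: "(i, k) \<in> r" "(j, k) \<in> r"
    using poset(5)[OF assms(1,2)] by blast
  then show ?thesis
    using sub[OF k(1)] sub[OF k(2)] f a
    by (simp add: is_substructure_iff[OF str[OF assms(1)]] is_substructure_iff[OF str[OF assms(2)]])
qed

text \<open>Comparison in a common upper bound again: the union of the relations adds nothing to a
  member on its own tuples.\<close>

lemma Rl_agree:
  assumes "i \<in> I" "j \<in> I" and R: "R \<in> Rels L"
    and a: "a \<in> tuples mu (rel_ar L R) (Univ (M i))" "a \<in> Rl (M j) R"
  shows "a \<in> Rl (M i) R"
proof -
  obtain k where k: "(i, k) \<in> r" "(j, k) \<in> r"
    using poset(5)[OF assms(1,2)] by blast
  have "a \<in> tuples mu (rel_ar L R) (Univ (M j))"
    using subsetD[OF Rl_subset_tuples[OF str[OF assms(2)] R] a(2)] .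
  then show ?thesis
    using sub[OF k(1)] sub[OF k(2)] R a
    by (simp add: is_substructure_iff[OF str[OF assms(1)]] is_substructure_iff[OF str[OF assms(2)]])
qed

abbreviation U where "U \<equiv> union_struct mu L I M"

lemma Univ_U: "Univ U = (\<Union>i\<in>I. Univ (M i))"
  by (simp add: union_struct_def)

lemma Fn_U:
  assumes i: "i \<in> I" and f: "f \<in> Funs L" and a: "a \<in> tuples mu (fun_ar L f) (Univ (M i))"
  shows "Fn U f a = Fn (M i) f a"
proof -
  let ?P = "\<lambda>i. i \<in> I \<and> a \<in> tuples mu (fun_ar L f) (Univ (M i))"
  have "?P (SOME i. ?P i)"
    using i a by (intro someI[of ?P i]) simp
  then have "Fn (M (SOME i. ?P i)) f a = Fn (M i) f a"
    using i f a by (intro Fn_agree) auto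
  moreover have "a \<in> tuples mu (fun_ar L f) (\<Union>i\<in>I. Univ (M i))"
    using i by (intro subsetD[OF tuples_mono a]) blast
  ultimately show ?thesis
    using f by (simp add: union_struct_def)
qed

lemma is_structure_U: "is_structure mu L U"
  unfolding is_structure_def
proof (intro conjI)
  have "Fn U f a \<in> Univ U" if f: "f \<in> Funs L" and a: "a \<in> tuples mu (fun_ar L f) (Univ U)" for f a
  proof -
    obtain i where "i \<in> I" "a \<in> tuples mu (fun_ar L f) (Univ (M i))"
      using tuple_in_member[OF arity_in_Field(1)[OF f] a[unfolded Univ_U]] by blast
    then show ?thesis
      using Fn_U[of i f a] f Fn_in_Univ[OF str, of i f a] by (auto simp: Univ_U)
  qed
  then show "Fn U \<in> (\<Pi>\<^sub>E f \<in> Funs L. tuples mu (fun_ar L f) (Univ U) \<rightarrow>\<^sub>E Univ U)"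
    by (auto simp: PiE_iff union_struct_def)
  have "Rl (M i) R \<subseteq> tuples mu (rel_ar L R) (\<Union>i\<in>I. Univ (M i))" if "i \<in> I" "R \<in> Rels L" for i R
    using Rl_subset_tuples[OF str[OF that(1)] that(2)]
    by (rule order_trans) (intro tuples_mono UN_upper that(1))
  then show "Rl U \<in> (\<Pi>\<^sub>E R \<in> Rels L. Pow (tuples mu (rel_ar L R) (Univ U)))"
    by (auto simp: PiE_iff union_struct_def)
qed

lemma is_substructure_U:
  assumes i: "i \<in> I"
  shows "is_substructure mu L (M i) U"
  unfolding is_substructure_iff[OF str[OF i]]
proof (intro conjI ballI)
  show "Univ (M i) \<subseteq> Univ U"
    using i by (auto simp: Univ_U)
  fix R a assume R: "R \<in> Rels L" and a: "a \<in> tuples mu (rel_ar L R) (Univ (M i))"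
  show "a \<in> Rl (M i) R \<longleftrightarrow> a \<in> Rl U R"
    using Rl_agree[OF i _ R a] i R by (auto simp: union_struct_def)
qed (use Fn_U i in auto)

definition incl_diagram :: "('i, ('f, 'r, 'b, 'u) struct, 'u \<Rightarrow> 'u) diagram" where
  "incl_diagram = \<lparr>Idx = I, Ord = r, Ob = M, Ar = (\<lambda>i j. \<lambda>x\<in>Univ (M i). x)\<rparr>"

lemma incl_diagram_simps [simp]:
  "Idx incl_diagram = I" "Ord incl_diagram = r" "Ob incl_diagram = M"
  "Ar incl_diagram = (\<lambda>i j. \<lambda>x\<in>Univ (M i). x)"
  by (simp_all add: incl_diagram_def)

lemma is_diagram_incl:
  assumes "\<And>i. i \<in> I \<Longrightarrow> |Univ (M i)| <o theta"
  shows "is_diagram (Emb theta mu L) incl_diagram"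
  using assms dir poset(1) str sub Univ_mono
  by (auto simp: is_diagram_def directed_poset_def Emb_simps is_substructure_def compose_incl)

text \<open>The map induced by a cocone \<open>d\<close> is the union of the maps \<open>d i\<close>.\<close>

lemma is_colimit_union:
  assumes N: "N \<in> Obj (Emb theta mu L)" and subN: "\<And>i. i \<in> I \<Longrightarrow> is_substructure mu L (M i) N"
    and UN: "Univ N = (\<Union>i\<in>I. Univ (M i))"
  shows "is_colimit (Emb theta mu L) incl_diagram N (\<lambda>i. \<lambda>x\<in>Univ (M i). x)"
  unfolding is_colimit_def
proof (intro conjI allI impI)
  show "is_cocone (Emb theta mu L) incl_diagram N (\<lambda>i. \<lambda>x\<in>Univ (M i). x)"
    using N subN Univ_mono by (auto simp: is_cocone_def Emb_simps compose_incl is_substructure_def)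
  fix Y d assume Y: "is_cocone (Emb theta mu L) incl_diagram Y d"
  have d: "is_embedding mu L (M i) Y (d i)" if "i \<in> I" for i
    using Y that by (simp add: is_cocone_def Emb_simps)
  have dij: "d i x = d j x" if "(i, j) \<in> r" "x \<in> Univ (M i)" for i j x
  proof -
    have "d i = restrict (d j) (Univ (M i))"
      using Y that(1) Univ_mono by (simp add: is_cocone_def Emb_simps compose_incl(1)[OF order_refl])
    then show ?thesis
      using that(2) by simp
  qed
  define h where "h = (\<lambda>x\<in>Univ N. d (SOME i. i \<in> I \<and> x \<in> Univ (M i)) x)"
  have h: "h x = d i x" if i: "i \<in> I" "x \<in> Univ (M i)" for i x
  proof -
    define j where "j = (SOME i. i \<in> I \<and> x \<in> Univ (M i))"
    have j: "j \<in> I \<and> x \<in> Univ (M j)"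
      using i unfolding j_def by (intro someI[of "\<lambda>i. i \<in> I \<and> x \<in> Univ (M i)" i]) simp
    then obtain k where k: "(i, k) \<in> r" "(j, k) \<in> r"
      using poset(5)[of i j] i(1) by blast
    have "d j x = d i x"
      using dij[OF k(1) i(2)] dij[OF k(2)] j by simp
    moreover have "x \<in> Univ N"
      using i UN by blast
    ultimately show ?thesis
      by (simp add: h_def j_def)
  qed
  have comp: "compose (underS mu n) h a = compose (underS mu n) (d i) a"
    if "i \<in> I" "a \<in> tuples mu n (Univ (M i))" for i n a
    using that h by (auto simp: compose_def tuples_def fun_eq_iff PiE_iff)
  have emb: "is_embedding mu L N Y h"
    unfolding is_embedding_def
  proof (intro conjI ballI)
    have "h x \<in> Univ Y" if "x \<in> Univ N" for x
      using that d h by (auto simp: UN is_embedding_def PiE_iff)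
    then show "h \<in> Univ N \<rightarrow>\<^sub>E Univ Y"
      by (auto simp: h_def PiE_iff)
    show "inj_on h (Univ N)"
    proof (rule inj_onI)
      fix x y assume "x \<in> Univ N" "y \<in> Univ N" and xy: "h x = h y"
      then obtain i j where "i \<in> I" "j \<in> I" "x \<in> Univ (M i)" "y \<in> Univ (M j)"
        by (auto simp: UN)
      moreover then obtain k where k: "k \<in> I" "(i, k) \<in> r" "(j, k) \<in> r"
        using poset(5) by blast
      ultimately have "x \<in> Univ (M k)" "y \<in> Univ (M k)"
        using Univ_mono by blast+
      then show "x = y"
        using d[OF k(1)] h[OF k(1)] xy by (auto simp: is_embedding_def dest: inj_onD)
    qed
  next
    fix f a assume f: "f \<in> Funs L" and a: "a \<in> tuples mu (fun_ar L f) (Univ N)"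
    obtain i where i: "i \<in> I" and ai: "a \<in> tuples mu (fun_ar L f) (Univ (M i))"
      using tuple_in_member[OF arity_in_Field(1)[OF f] a[unfolded UN]] by blast
    have "Fn N f a = Fn (M i) f a"
      using subN[OF i] f ai by (simp add: is_substructure_iff[OF str[OF i]])
    then show "h (Fn N f a) = Fn Y f (compose (underS mu (fun_ar L f)) h a)"
      using h[OF i Fn_in_Univ[OF str[OF i] f ai]] comp[OF i ai] d[OF i] f ai
      by (simp add: is_embedding_def)
  next
    fix R a assume R: "R \<in> Rels L" and a: "a \<in> tuples mu (rel_ar L R) (Univ N)"
    obtain i where i: "i \<in> I" and ai: "a \<in> tuples mu (rel_ar L R) (Univ (M i))"
      using tuple_in_member[OF arity_in_Field(2)[OF R] a[unfolded UN]] by blast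
    have "a \<in> Rl N R \<longleftrightarrow> a \<in> Rl (M i) R"
      using subN[OF i] R ai by (simp add: is_substructure_iff[OF str[OF i]])
    then show "a \<in> Rl N R \<longleftrightarrow> compose (underS mu (rel_ar L R)) h a \<in> Rl Y R"
      using comp[OF i ai] d[OF i] R ai by (simp add: is_embedding_def)
  qed
  show "\<exists>!h. h \<in> Hom (Emb theta mu L) N Y \<and>
    (\<forall>i\<in>Idx incl_diagram. Comp (Emb theta mu L) (Ob incl_diagram i) N Y h (\<lambda>x\<in>Univ (M i). x) = d i)"
  proof (rule ex1I[of _ h])
    have "restrict h (Univ (M i)) = d i" if "i \<in> I" for i
      using h[OF that] d[OF that] by (auto simp: is_embedding_def PiE_iff extensional_def fun_eq_iff)
    then show "h \<in> Hom (Emb theta mu L) N Y \<and>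
      (\<forall>i\<in>Idx incl_diagram. Comp (Emb theta mu L) (Ob incl_diagram i) N Y h (\<lambda>x\<in>Univ (M i). x) = d i)"
      using emb by (simp add: Emb_simps compose_incl(1)[OF order_refl])
  next
    fix g assume g: "g \<in> Hom (Emb theta mu L) N Y \<and>
      (\<forall>i\<in>Idx incl_diagram. Comp (Emb theta mu L) (Ob incl_diagram i) N Y g (\<lambda>x\<in>Univ (M i). x) = d i)"
    then have gi: "restrict g (Univ (M i)) = d i" if "i \<in> I" for i
      using that by (simp add: Emb_simps compose_incl(1)[OF order_refl])
    show "g = h"
    proof
      fix x show "g x = h x"
      proof (cases "x \<in> Univ N")
        case True
        then obtain i where i: "i \<in> I" "x \<in> Univ (M i)"
          by (auto simp: UN)
        then show ?thesis
          using fun_cong[OF gi[OF i(1)], of x] h[OF i] by simp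
      next
        case False
        then show ?thesis
          using g emb by (simp add: Emb_simps is_embedding_def PiE_iff extensional_def)
      qed
    qed
  qed
qed

end


section \<open>Presentable structures\<close>

lemma colimit_induced:
  assumes "is_colimit C D X c" and "is_cocone C D Y d"
  shows "\<exists>h \<in> Hom C X Y. \<forall>i \<in> Idx D. Comp C (Ob D i) X Y h (c i) = d i"
proof -
  have "\<exists>!h. h \<in> Hom C X Y \<and> (\<forall>i \<in> Idx D. Comp C (Ob D i) X Y h (c i) = d i)"
    using assms by (simp add: is_colimit_def)
  then show ?thesis
    by blast
qed

text \<open>The cocone \<open>d\<close> induces \<open>h : X -> U\<close>. Both \<open>m h\<close>
  and the identity of \<open>X\<close> carry the cocone \<open>c\<close> to itself, so they coincide
  by uniqueness. With \<open>m\<close> an inclusion, this forces the part \<open>U\<close> to be all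
  of \<open>X\<close>.\<close>

lemma colimit_section:
  assumes C: "is_category C" and D: "is_diagram C D" and X: "is_colimit C D X c"
    and U: "is_cocone C D U d" and m: "m \<in> Hom C U X"
    and md: "\<And>i. i \<in> Idx D \<Longrightarrow> Comp C (Ob D i) U X m (d i) = c i"
  shows "\<exists>h \<in> Hom C X U. Comp C X U X m h = Id C X"
proof -
  have cX: "is_cocone C D X c"
    using X by (simp add: is_colimit_def)
  have ob: "X \<in> Obj C" "U \<in> Obj C" "\<And>i. i \<in> Idx D \<Longrightarrow> Ob D i \<in> Obj C"
    and c: "\<And>i. i \<in> Idx D \<Longrightarrow> c i \<in> Hom C (Ob D i) X"
    using cX U D by (simp_all add: is_cocone_def is_diagram_def)
  obtain h where h: "h \<in> Hom C X U" "\<And>i. i \<in> Idx D \<Longrightarrow> Comp C (Ob D i) X U h (c i) = d i"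
    using colimit_induced[OF X U] by blast
  have mh: "Comp C X U X m h \<in> Hom C X X"
    using C ob h(1) m by (simp add: is_category_def)
  moreover have "Comp C (Ob D i) X X (Comp C X U X m h) (c i) = c i" if "i \<in> Idx D" for i
    using C ob c h m md that by (simp add: is_category_def)
  moreover have "Id C X \<in> Hom C X X"
    using C ob by (simp add: is_category_def)
  moreover have "Comp C (Ob D i) X X (Id C X) (c i) = c i" if "i \<in> Idx D" for i
    using C ob c that by (simp add: is_category_def)
  moreover have "\<exists>!k. k \<in> Hom C X X \<and> (\<forall>i\<in>Idx D. Comp C (Ob D i) X X k (c i) = c i)"
    using X cX by (simp add: is_colimit_def)
  ultimately have "Comp C X U X m h = Id C X"
    by blast
  then show ?thesis
    using h(1) by blast
qed

text \<open>In the category of sets, the images of a colimit cocone cover the colimit.\<close>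

lemma presentable_factorization:
  assumes C: "is_category C" and M: "presentable theta kappa C M"
    and D: "directed_diagram theta kappa C D" and X: "is_colimit C D X c" and f: "f \<in> Hom C M X"
  shows "\<exists>i \<in> Idx D. \<exists>g \<in> Hom C M (Ob D i). Comp C M (Ob D i) X (c i) g = f"
proof -
  let ?F = "hom_functor C M"
  let ?D = "map_diagram ?F D"
  define d where "d = (\<lambda>i. \<lambda>g\<in>Hom C M (Ob D i). Comp C M (Ob D i) X (c i) g)"
  \<comment> \<open>\<open>U\<close> is the set of morphisms \<open>M -> X\<close> that factor
    through some \<open>c i\<close>; the goal is \<open>f \<in> U\<close>.\<close>
  define U where "U = (\<Union>i\<in>Idx D. d i ` Hom C M (Ob D i))"
  have MC: "M \<in> Obj C"
    using M by (simp add: presentable_def)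
  have dia: "is_diagram C D"
    using D by (simp add: directed_diagram_def)
  have coX: "is_cocone C D X c"
    using X by (simp add: is_colimit_def)
  have "is_colimit Set_cat ?D (on_obj ?F X) (\<lambda>i. on_arr ?F (Ob D i) X (c i))"
    using M D X unfolding presentable_def preserves_directed_colimits_def by blast
  then have col: "is_colimit Set_cat ?D (Hom C M X) d"
    by (simp add: hom_functor_def d_def)
  then have co: "is_cocone Set_cat ?D (Hom C M X) d"
    by (simp add: is_colimit_def)
  have U: "U \<subseteq> Hom C M X"
    using co by (auto simp: is_cocone_def U_def Set_cat_def map_diagram_def hom_functor_def PiE_iff)
  have "is_cocone Set_cat ?D U d"
    unfolding is_cocone_def
  proof (intro conjI ballI allI impI)
    show "U \<in> Obj Set_cat"
      by (simp add: Set_cat_def)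
    show "d i \<in> Hom Set_cat (Ob ?D i) U" if "i \<in> Idx ?D" for i
      using that by (auto simp: U_def Set_cat_def map_diagram_def hom_functor_def d_def)
    show "d i = Comp Set_cat (Ob ?D i) (Ob ?D j) U (d j) (Ar ?D i j)" if "(i, j) \<in> Ord ?D" for i j
      using co that by (simp add: is_cocone_def Set_cat_def)
  qed
  moreover have "is_diagram Set_cat ?D"
    unfolding is_diagram_def
  proof (intro conjI ballI allI impI)
    show "partial_order_on (Idx ?D) (Ord ?D)"
      using dia by (simp add: map_diagram_def is_diagram_def)
    have r: "Ord D \<subseteq> Idx D \<times> Idx D"
      using dia by (simp add: is_diagram_def partial_order_on_def preorder_on_def)
    have Ob: "Ob D i \<in> Obj C" if "i \<in> Idx D" for i
      using dia that by (simp add: is_diagram_def)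
    show "Ob ?D i \<in> Obj Set_cat" if "i \<in> Idx ?D" for i
      by (simp add: Set_cat_def)
    show "Ar ?D i i = Id Set_cat (Ob ?D i)" if "i \<in> Idx ?D" for i
      using that dia C MC
      by (auto simp: map_diagram_def hom_functor_def Set_cat_def is_diagram_def is_category_def
          fun_eq_iff)
    show "Ar ?D i j \<in> Hom Set_cat (Ob ?D i) (Ob ?D j)" if ij: "(i, j) \<in> Ord ?D" for i j
    proof -
      have "i \<in> Idx D" "j \<in> Idx D" "Ar D i j \<in> Hom C (Ob D i) (Ob D j)"
        using ij r dia by (auto simp: map_diagram_def is_diagram_def)
      then show ?thesis
        using C MC Ob by (simp add: map_diagram_def hom_functor_def Set_cat_def is_category_def)
    qed
    show "Ar ?D i k = Comp Set_cat (Ob ?D i) (Ob ?D j) (Ob ?D k) (Ar ?D j k) (Ar ?D i j)"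
      if ijk: "(i, j) \<in> Ord ?D \<and> (j, k) \<in> Ord ?D" for i j k
    proof -
      have ij: "(i, j) \<in> Ord D" and jk: "(j, k) \<in> Ord D"
        using ijk by (simp_all add: map_diagram_def)
      then have obs: "Ob D i \<in> Obj C" "Ob D j \<in> Obj C" "Ob D k \<in> Obj C"
        using r Ob by auto
      have ars: "Ar D i j \<in> Hom C (Ob D i) (Ob D j)" "Ar D j k \<in> Hom C (Ob D j) (Ob D k)"
        using ij jk dia by (simp_all add: is_diagram_def)
      have eq: "Ar D i k = Comp C (Ob D i) (Ob D j) (Ob D k) (Ar D j k) (Ar D i j)"
        using dia ij jk unfolding is_diagram_def by blast
      have "Comp C M (Ob D i) (Ob D j) (Ar D i j) g \<in> Hom C M (Ob D j)"
        "Comp C M (Ob D i) (Ob D k) (Ar D i k) g =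
          Comp C M (Ob D j) (Ob D k) (Ar D j k) (Comp C M (Ob D i) (Ob D j) (Ar D i j) g)"
        if "g \<in> Hom C M (Ob D i)" for g
        using C MC obs ars that unfolding eq by (simp_all add: is_category_def)
      then show ?thesis
        by (auto simp: map_diagram_def hom_functor_def Set_cat_def compose_def fun_eq_iff)
    qed
  qed
  moreover have "(\<lambda>x\<in>U. x) \<in> Hom Set_cat U (Hom C M X)"
    using U by (auto simp: Set_cat_def)
  moreover have "Comp Set_cat (Ob ?D i) U (Hom C M X) (\<lambda>x\<in>U. x) (d i) = d i" if "i \<in> Idx ?D" for i
    using that
    by (auto simp: Set_cat_def compose_def fun_eq_iff U_def map_diagram_def hom_functor_def d_def)
  ultimately obtain h where h: "h \<in> Hom Set_cat (Hom C M X) U"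
    "Comp Set_cat (Hom C M X) U (Hom C M X) (\<lambda>x\<in>U. x) h = Id Set_cat (Hom C M X)"
    using colimit_section[OF is_category_Set_cat _ col] by blast
  have "h f \<in> U"
    using h(1) f by (auto simp: Set_cat_def)
  moreover have "h f = f"
    using fun_cong[OF h(2), of f] f \<open>h f \<in> U\<close> by (simp add: Set_cat_def compose_def)
  ultimately show ?thesis
    by (auto simp: U_def d_def)
qed

section \<open>Generated substructures and their size\<close>

text \<open>One round of applying the function symbols. That \<open>closed_op\<close> only tests
  small \<open>Y\<close> loses nothing, since the entries of a tuple form a set of size
  \<open>< mu\<close>.\<close>

definition gen_op :: "'b rel \<Rightarrow> ('f, 'r, 'b) signature \<Rightarrow> ('f, 'r, 'b, 'u) struct \<Rightarrow> 'u set \<Rightarrow> 'u set"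
  where
  "gen_op mu L M Y = (\<Union>f\<in>Funs L. Fn M f ` tuples mu (fun_ar L f) Y)"

lemma closed_op_gen_op_Univ:
  assumes "is_structure mu L M"
  shows "closed_op mu (gen_op mu L M) (Univ M)"
  unfolding closed_op_def gen_op_def
proof (intro allI impI UN_least image_subsetI)
  fix Y f a assume "Y \<subseteq> Univ M \<and> |Y| <o mu" "f \<in> Funs L" "a \<in> tuples mu (fun_ar L f) Y"
  moreover then have "a \<in> tuples mu (fun_ar L f) (Univ M)"
    using subsetD[OF tuples_mono[of Y "Univ M"], of a] by simp
  ultimately show "Fn M f a \<in> Univ M"
    using Fn_in_Univ[OF assms] by simp
qed

lemma closed_in_if_closed_op:
  assumes mu: "Card_order mu" and ary: "mu_ary mu L"
    and S: "S \<subseteq> Univ M" "closed_op mu (gen_op mu L M) S"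
  shows "closed_in mu L M S"
  unfolding closed_in_def
proof (intro conjI ballI)
  fix f a assume f: "f \<in> Funs L" and a: "a \<in> tuples mu (fun_ar L f) S"
  let ?Y = "a ` underS mu (fun_ar L f)"
  have "fun_ar L f \<in> Field mu"
    using ary f by (auto simp: mu_ary_def)
  then have "|?Y| <o mu"
    by (intro small_image card_of_underS[OF mu])
  moreover have "?Y \<subseteq> S"
    using a by (auto simp: tuples_def)
  ultimately have "gen_op mu L M ?Y \<subseteq> S"
    using S(2) by (simp add: closed_op_def)
  moreover have "a \<in> tuples mu (fun_ar L f) ?Y"
    using a by (auto simp: tuples_def PiE_iff)
  ultimately show "Fn M f a \<in> S"
    using f by (auto simp: gen_op_def)
qed (rule S(1))

text \<open>At most \<open>|C|\<close> symbols contribute, each with at most \<open>C^{<mu}\<close>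
  values, and \<open>C^{<mu}\<close> is bounded by \<open>|C|\<close>.\<close>

lemma card_gen_op:
  assumes mu: "regular_cardinal mu" and ary: "mu_ary mu L"
    and C: "|small_subsets mu C| \<le>o |C|" "mu \<le>o |C|" and L: "|Funs L| \<le>o |C|" and Y: "|Y| <o mu"
  shows "|gen_op mu L M Y| \<le>o |C|"
proof -
  have inf: "\<not> finite C"
    using regular_cardinalD(3)[OF mu] cinfinite_mono[OF C(2)] by (simp add: cinfinite_def Field_card_of)
  have YC: "|Y| \<le>o |C|"
    using ordLeq_transitive[OF ordLess_imp_ordLeq[OF Y] C(2)] .
  have "|Fn M f ` tuples mu (fun_ar L f) Y| \<le>o |C|" if "f \<in> Funs L" for f
  proof -
    have "|tuples mu (fun_ar L f) Y| \<le>o less_power Y mu"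
      unfolding less_power_def
      using ary that by (intro inj_on_imp_ordLeq[of "Pair (fun_ar L f)"]) (auto simp: inj_on_def mu_ary_def)
    then have "|tuples mu (fun_ar L f) Y| \<le>o |C|"
      using less_power_mono_card[OF YC] less_power_le_small_subsets[OF mu C(2)] C(1)
      by (meson ordLeq_transitive)
    then show ?thesis
      using card_of_image by (rule ordLeq_transitive[rotated])
  qed
  then show ?thesis
    unfolding gen_op_def using inf L by (intro card_of_UNION_ordLeq_infinite) auto
qed

lemma presentable_Emb_card:
  fixes theta :: "'u rel" and mu :: "'b rel" and kappa :: "'k rel"
    and M :: "('f, 'r, 'b, 'u) struct"
  assumes univ: "universe theta kappa" and mu: "regular_cardinal mu" and ary: "mu_ary mu L"
    and kappa: "regular_cardinal kappa" and mu_kappa: "mu \<le>o kappa" and L_kappa: "|Funs L| \<le>o kappa"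
    and M: "presentable theta kappa (Emb theta mu L) M"
  shows "|Univ M| \<le>o |small_subsets mu (Field kappa)|"
proof -
  let ?C = "small_subsets mu (Field kappa)"
  have kF: "kappa =o |Field kappa|"
    using ordIso_symmetric card_of_Field_ordIso regular_cardinalD(1)[OF kappa] by blast
  have muF: "mu \<le>o |Field kappa|"
    using ordLeq_ordIso_trans[OF mu_kappa kF] .
  have kC: "kappa \<le>o |?C|"
    using ordIso_ordLeq_trans[OF kF card_le_small_subsets[OF mu]] .
  have C: "|small_subsets mu ?C| \<le>o |?C|" "mu \<le>o |?C|"
    using small_subsets_idem[OF mu muF] ordLeq_transitive[OF mu_kappa kC] by auto
  have MC: "is_structure mu L M" "|Univ M| <o theta"
    using M by (simp_all add: presentable_def Emb_simps)
  define H where "H = (\<lambda>X. closed_op mu (gen_op mu L M) hull X)"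
  have H_mono: "X \<subseteq> Y \<Longrightarrow> H X \<subseteq> H Y" for X Y
    unfolding H_def by (rule hull_mono)
  have H_subset: "X \<subseteq> H X" for X
    unfolding H_def by (rule hull_subset)
  have H_Univ: "H X \<subseteq> Univ M" if "X \<subseteq> Univ M" for X
    unfolding H_def using that closed_op_gen_op_Univ[OF MC(1)] by (rule hull_minimal)
  have H_closed: "closed_in mu L M (H X)" if "X \<subseteq> Univ M" for X
    using regular_cardinalD(1)[OF mu] ary H_Univ[OF that]
    by (rule closed_in_if_closed_op) (simp add: H_def closed_op_hull)
  define S where "S = small_subsets kappa (Univ M)"
  \<comment> \<open>The last clause of \<open>universe\<close> states just this smallness.\<close>
  have S: "|S| <o theta"
    using univ MC(2) by (simp add: universe_def S_def small_subsets_def)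
  \<comment> \<open>Diagrams are indexed by elements of \<open>'u\<close>, so the subsets in
    \<open>S\<close> are coded by elements of \<open>'u\<close>, with \<open>X\<close> as
    decoding.\<close>
  obtain B :: "'u set" where "|S| =o |B|"
    using S internalize_card_of_ordLess[of S theta] by blast
  then obtain e :: "'u set \<Rightarrow> 'u" where e: "inj_on e S"
    by (auto simp: card_of_ordIso[symmetric] bij_betw_def)
  define I where "I = e ` S"
  define X where "X = inv_into S e"
  have X: "X i \<in> S" if "i \<in> I" for i
    using that by (simp add: X_def I_def inv_into_into)
  have XI: "\<exists>i\<in>I. X i = Y" if "Y \<in> S" for Y
    using that e by (auto simp: X_def I_def)
  have X_inj: "i = j" if "i \<in> I" "j \<in> I" "X i = X j" for i j
    using that by (metis I_def X_def inv_into_injective)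
  have X_Univ: "X i \<subseteq> Univ M" and X_small: "|X i| <o kappa" if "i \<in> I" for i
    using X[OF that] by (auto simp: S_def small_subsets_def)
  define r where "r = {(i, j). i \<in> I \<and> j \<in> I \<and> X i \<subseteq> X j}"
  define N where "N = (\<lambda>i. sub_struct mu L M (H (X i)))"
  have dirk: "directed_poset kappa I r"
    unfolding directed_poset_def
  proof (intro conjI allI impI)
    show "partial_order_on I r"
      unfolding partial_order_on_def preorder_on_def
      using X_inj by (auto simp: r_def refl_on_def intro!: transI antisymI)
    fix T assume T: "T \<subseteq> I \<and> |T| <o kappa"
    \<comment> \<open>The upper bound of \<open>T\<close> is the index of the union of its
      generating sets, which is again of size \<open>< kappa\<close> since \<open>kappa\<close> is
      regular.\<close>
    have "|\<Union>i\<in>T. X i| <o kappa"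
      using T X_small by (intro stable_UNION regular_cardinalD(5)[OF kappa]) auto
    moreover have "(\<Union>i\<in>T. X i) \<subseteq> Univ M"
      using T X_Univ by blast
    ultimately obtain u where u: "u \<in> I" "X u = (\<Union>i\<in>T. X i)"
      using XI[of "\<Union>i\<in>T. X i"] by (auto simp: S_def small_subsets_def)
    then show "\<exists>u\<in>I. \<forall>x\<in>T. (x, u) \<in> r"
      using T by (intro bexI[of _ u]) (auto simp: r_def)
  qed
  have N: "is_structure mu L (N i)" "is_substructure mu L (N i) M" "Univ (N i) \<subseteq> Univ M" if "i \<in> I" for i
    using H_closed[OF X_Univ[OF that]] H_Univ[OF X_Univ[OF that]]
    by (simp_all add: N_def is_structure_sub_struct is_substructure_sub_struct)
  interpret directed_structures mu L I r N
  proof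
    show "directed_poset mu I r"
      using dirk mu_kappa by (rule directed_poset_mono)
    show "is_substructure mu L (N i) (N j)" if "(i, j) \<in> r" for i j
    proof -
      have ij: "i \<in> I" "j \<in> I" and "X i \<subseteq> X j"
        using that by (auto simp: r_def)
      then have "Univ (N i) \<subseteq> Univ (N j)"
        by (simp add: N_def H_mono)
      then show ?thesis
        by (rule is_substructure_cancel[OF N(1)[OF ij(1)] N(1)[OF ij(2)] N(2)[OF ij(1)] N(2)[OF ij(2)]])
    qed
  qed (fact mu ary N(1))+
  have "Univ M = (\<Union>i\<in>I. Univ (N i))"
  proof (intro equalityI subsetI)
    fix x assume x: "x \<in> Univ M"
    then have "{x} \<in> S"
      using small_finite[OF kappa, of "{x}"] by (simp add: S_def small_subsets_def)
    then obtain i where i: "i \<in> I" "X i = {x}"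
      using XI by blast
    have "x \<in> Univ (N i)"
      using H_subset[of "X i"] i(2) by (auto simp: N_def)
    then show "x \<in> (\<Union>i\<in>I. Univ (N i))"
      using i(1) by blast
  qed (use N(3) in blast)
  then have "is_colimit (Emb theta mu L) incl_diagram M (\<lambda>i. \<lambda>x\<in>Univ (N i). x)"
    using MC N(2) by (intro is_colimit_union) (auto simp: Emb_simps)
  moreover have "directed_diagram theta kappa (Emb theta mu L) incl_diagram"
  proof -
    have "|I| <o theta"
      unfolding I_def using S by (rule small_image)
    moreover have "is_diagram (Emb theta mu L) incl_diagram"
      using ordLeq_ordLess_trans[OF card_of_mono1[OF N(3)] MC(2)] by (rule is_diagram_incl)
    ultimately show ?thesis
      using dirk by (simp add: directed_diagram_def)
  qed
  moreover have "(\<lambda>x\<in>Univ M. x) \<in> Hom (Emb theta mu L) M M"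
    by (simp add: Emb_simps is_embedding_id MC(1))
  ultimately obtain i g where i: "i \<in> I" and g: "is_embedding mu L M (N i) g"
    and eq: "compose (Univ M) (\<lambda>x\<in>Univ (N i). x) g = (\<lambda>x\<in>Univ M. x)"
    using presentable_factorization[OF is_category_Emb M, of incl_diagram M "\<lambda>i. \<lambda>x\<in>Univ (N i). x"
        "\<lambda>x\<in>Univ M. x"]
    by (auto simp: Emb_simps)
  \<comment> \<open>By \<open>eq\<close> the map \<open>g\<close> into \<open>N i\<close> moves no
    point. Thus \<open>M\<close> is itself generated by the fewer than \<open>kappa\<close> elements
    of \<open>X i\<close>.\<close>
  have "Univ M \<subseteq> H (X i)"
  proof
    fix x assume x: "x \<in> Univ M"
    then have "g x \<in> Univ (N i)"
      using g by (auto simp: is_embedding_def)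
    then show "x \<in> H (X i)"
      using fun_cong[OF eq, of x] x by (simp add: compose_def N_def)
  qed
  moreover have "|H (X i)| \<le>o |?C|"
    unfolding H_def
  proof (rule card_closed_op_hull[OF mu C])
    show "|gen_op mu L M Y| \<le>o |?C|" if "|Y| <o mu" for Y
      using card_gen_op[OF mu ary C ordLeq_transitive[OF L_kappa kC] that] .
    show "|X i| \<le>o |?C|"
      using ordLeq_transitive[OF ordLess_imp_ordLeq[OF X_small[OF i]] kC] .
  qed
  ultimately show ?thesis
    by (rule ordLeq_transitive[OF card_of_mono1])
qed


section \<open>The abstract elementary class\<close>

locale embedding_subcategory =
  fixes theta :: "'u rel" and mu :: "'b rel" and kappa :: "'k rel"
    and L :: "('f, 'r, 'b) signature"
    and K :: "(('f, 'r, 'b, 'u) struct, 'u \<Rightarrow> 'u) category"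
  assumes univ: "universe theta kappa"
    and mu: "regular_cardinal mu" and ary: "mu_ary mu L"
    and kappa: "regular_cardinal kappa" and mu_L_kappa: "mu +c sig_card L \<le>o kappa"
    and subcat: "subcategory K (Emb theta mu L)"
    and isofull: "iso_full K (Emb theta mu L)"
    and replete: "replete K (Emb theta mu L)"
    and coherent: "coherent K (Emb theta mu L)"
    and accessible: "accessible theta kappa K"
    and closed: "closed_under_directed_colimits theta mu K (Emb theta mu L)"
    and presentable: "\<forall>M. presentable theta kappa K M \<longrightarrow> presentable theta kappa (Emb theta mu L) M"
begin

lemma theta: "regular_cardinal theta"
  using univ by (simp add: universe_def)

lemma mu_kappa: "mu \<le>o kappa"
  using ordLeq_csum1[OF regular_cardinalD(1)[OF mu]] mu_L_kappa by (rule ordLeq_transitive)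

lemma L_kappa: "|Funs L| \<le>o kappa"
proof -
  have "|Funs L| \<le>o sig_card L"
    unfolding sig_card_def by (rule card_of_Plus1)
  moreover have "sig_card L \<le>o mu +c sig_card L"
    unfolding sig_card_def by (rule ordLeq_csum2) (rule card_of_Card_order)
  ultimately show ?thesis
    using mu_L_kappa by (meson ordLeq_transitive)
qed

lemma Obj_K: "M \<in> Obj K \<Longrightarrow> is_structure mu L M \<and> |Univ M| <o theta"
  using subcat by (auto simp: subcategory_def Emb_simps)

lemma Obj_K_Emb: "M \<in> Obj K \<Longrightarrow> M \<in> Obj (Emb theta mu L)"
  using subcat by (auto simp: subcategory_def)

lemma Hom_K: "M \<in> Obj K \<Longrightarrow> N \<in> Obj K \<Longrightarrow> h \<in> Hom K M N \<Longrightarrow> is_embedding mu L M N h"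
  using subcat by (auto simp: subcategory_def Emb_simps)

lemma Id_K: "Id K M = (\<lambda>x\<in>Univ M. x)"
  and Comp_K: "Comp K M N P g f = compose (Univ M) g f"
  using subcat by (simp_all add: subcategory_def Emb_simps)

lemma id_Hom_K: "M \<in> Obj K \<Longrightarrow> (\<lambda>x\<in>Univ M. x) \<in> Hom K M M"
  using subcat by (auto simp: subcategory_def Emb_simps)

lemma compose_Hom_K:
  assumes "M \<in> Obj K" "N \<in> Obj K" "P \<in> Obj K" "f \<in> Hom K M N" "g \<in> Hom K N P"
  shows "compose (Univ M) g f \<in> Hom K M P"
  using subcat assms by (auto simp: subcategory_def Emb_simps)

lemma is_category_K: "is_category K"
  using subcat is_category_Emb by (rule subcategory_is_category)

text \<open>Repleteness gives the first conclusion and iso-fullness the second; the smallness that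
  membership in \<open>Emb\<close> demands of \<open>N\<close> is carried over by
  \<open>h\<close>.\<close>

lemma isomorphism_Obj_K:
  assumes M: "M \<in> Obj K" and N: "is_structure mu L N" and h: "is_isomorphism mu L M N h"
  shows "N \<in> Obj K" "h \<in> Hom K M N"
proof -
  have "Univ N = h ` Univ M"
    using h by (simp add: is_isomorphism_def)
  then have "|Univ N| <o theta"
    using Obj_K[OF M] by (simp add: small_image)
  then have N': "N \<in> Obj (Emb theta mu L)"
    using N by (simp add: Emb_simps)
  then have iso: "iso (Emb theta mu L) M N h"
    using h iso_Emb_iff Obj_K_Emb[OF M] by blast
  then show NK: "N \<in> Obj K"
    using replete M N' unfolding replete_def by blast
  show "h \<in> Hom K M N"
    using isofull M NK iso unfolding iso_full_def by blast
qed

section \<open>The order of the class and its axioms\<close>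

abbreviation le :: "('f, 'r, 'b, 'u) struct \<Rightarrow> ('f, 'r, 'b, 'u) struct \<Rightarrow> bool" (infix "\<preceq>" 50)
  where "M \<preceq> N \<equiv> sub_le K mu L M N"

lemma le_refl:
  assumes "M \<in> Obj K"
  shows "M \<preceq> M"
proof -
  have "is_substructure mu L M M"
    using Obj_K[OF assms] by (simp add: is_substructure_def is_embedding_id)
  then show ?thesis
    using assms id_Hom_K by (simp add: sub_le_def)
qed

lemma le_trans:
  assumes "M \<preceq> N" "N \<preceq> P"
  shows "M \<preceq> P"
proof -
  have sub: "Univ M \<subseteq> Univ N" "Univ N \<subseteq> Univ P"
    and ob: "M \<in> Obj K" "N \<in> Obj K" "P \<in> Obj K"
    and hom: "(\<lambda>x\<in>Univ M. x) \<in> Hom K M N" "(\<lambda>x\<in>Univ N. x) \<in> Hom K N P"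
    using assms by (simp_all add: sub_le_def is_substructure_def)
  have "(\<lambda>x\<in>Univ M. x) \<in> Hom K M P"
    using compose_Hom_K[OF ob hom] compose_incl(2)[OF sub(1)] by simp
  moreover then have "is_substructure mu L M P"
    using Hom_K[OF ob(1,3)] order_trans[OF sub] by (simp add: is_substructure_def)
  ultimately show ?thesis
    using ob by (simp add: sub_le_def)
qed

text \<open>Coherence of the subcategory, applied to a triangle of inclusions. The last hypothesis
  can speak of universes because agreement with \<open>M2\<close> makes \<open>M0\<close> a
  substructure of \<open>M1\<close>.\<close>

lemma le_cancel:
  assumes le: "M0 \<preceq> M2" "M1 \<preceq> M2" and sub: "Univ M0 \<subseteq> Univ M1"
  shows "M0 \<preceq> M1"
proof -
  have ob: "M0 \<in> Obj K" "M1 \<in> Obj K" "M2 \<in> Obj K"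
    and hom: "(\<lambda>x\<in>Univ M0. x) \<in> Hom K M0 M2" "(\<lambda>x\<in>Univ M1. x) \<in> Hom K M1 M2"
    using le by (simp_all add: sub_le_def)
  have "is_substructure mu L M0 M1"
    using le Obj_K ob sub by (intro is_substructure_cancel[of mu L M0 M1 M2]) (simp_all add: sub_le_def)
  moreover from this have "(\<lambda>x\<in>Univ M0. x) \<in> Hom (Emb theta mu L) M0 M1"
    by (simp add: is_substructure_def Emb_simps)
  moreover have "Comp (Emb theta mu L) M0 M1 M2 (\<lambda>x\<in>Univ M1. x) (\<lambda>x\<in>Univ M0. x) = (\<lambda>x\<in>Univ M0. x)"
    using compose_incl(2)[OF sub] by (simp add: Emb_simps)
  ultimately show ?thesis
    using coherent ob hom unfolding coherent_def sub_le_def by blast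
qed

text \<open>The inclusion of \<open>N0\<close> into \<open>N1\<close> is the composite of the
  inverse of the restricted \<open>h\<close>, the inclusion of \<open>M0\<close> into
  \<open>M1\<close>, and \<open>h\<close>. Iso-fullness puts the two outer maps into
  \<open>K\<close>.\<close>

lemma le_isomorphic:
  assumes le: "M0 \<preceq> M1" and N: "is_structure mu L N0" "is_structure mu L N1"
    and sub: "is_substructure mu L N0 N1"
    and h: "is_isomorphism mu L M1 N1 h" "is_isomorphism mu L M0 N0 (restrict h (Univ M0))"
  shows "N0 \<preceq> N1"
proof -
  have M: "M0 \<in> Obj K" "M1 \<in> Obj K" and hom: "(\<lambda>x\<in>Univ M0. x) \<in> Hom K M0 M1"
    and M01: "Univ M0 \<subseteq> Univ M1"
    using le by (simp_all add: sub_le_def is_substructure_def)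
  note N1 = isomorphism_Obj_K[OF M(2) N(2) h(1)]
  note N0 = isomorphism_Obj_K[OF M(1) N(1) h(2)]
  obtain g where g: "is_isomorphism mu L N0 M0 g"
    and hg: "compose (Univ N0) (restrict h (Univ M0)) g = (\<lambda>x\<in>Univ N0. x)"
    using is_isomorphism_inverse[OF _ N(1) h(2)] Obj_K[OF M(1)] by metis
  have gK: "g \<in> Hom K N0 M0"
    using isomorphism_Obj_K[OF N0(1) _ g] Obj_K[OF M(1)] by simp
  have "restrict h (Univ M0) \<in> Hom K M0 N1"
    using compose_Hom_K[OF M N1(1) hom N1(2)] by (simp add: compose_incl(1)[OF order_refl])
  then have "(\<lambda>x\<in>Univ N0. x) \<in> Hom K N0 N1"
    using compose_Hom_K[OF N0(1) M(1) N1(1) gK] hg by metis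
  then show ?thesis
    using N0(1) N1(1) sub by (simp add: sub_le_def)
qed

lemma abstract_class: "abstract_class theta mu L (Obj K) (sub_le K mu L)"
  unfolding abstract_class_def
proof (intro conjI allI ballI impI)
  show "M \<preceq> P" if "M \<preceq> N \<and> N \<preceq> P" for M N P
    using that le_trans by blast
  show "N \<in> Obj K" if "M \<in> Obj K \<and> is_structure mu L N \<and> is_isomorphism mu L M N h" for M N h
    using that isomorphism_Obj_K(1) by blast
  show "N0 \<preceq> N1"
    if "M0 \<preceq> M1 \<and> is_structure mu L N0 \<and> is_structure mu L N1 \<and> is_substructure mu L N0 N1 \<and>
      is_isomorphism mu L M1 N1 h \<and> is_isomorphism mu L M0 N0 (restrict h (Univ M0))"
    for M0 M1 N0 N1 h
    using that le_isomorphic by blast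
qed (simp_all add: ary Obj_K le_refl, simp_all add: sub_le_def)

lemma coherence_axiom: "coherence_axiom mu L (Obj K) (sub_le K mu L)"
  unfolding coherence_axiom_def by (auto simp: is_substructure_def intro: le_cancel)

lemma tarski_vaught:
  fixes I :: "'u set" and M :: "'u \<Rightarrow> ('f, 'r, 'b, 'u) struct"
  assumes I: "|I| <o theta" and dir: "directed_poset mu I r" and M: "\<And>i. i \<in> I \<Longrightarrow> M i \<in> Obj K"
    and le: "\<And>i j. (i, j) \<in> r \<Longrightarrow> M i \<preceq> M j"
  shows "union_struct mu L I M \<in> Obj K" "\<And>i. i \<in> I \<Longrightarrow> M i \<preceq> union_struct mu L I M"
    "\<And>N. N \<in> Obj K \<Longrightarrow> (\<And>i. i \<in> I \<Longrightarrow> M i \<preceq> N) \<Longrightarrow> union_struct mu L I M \<preceq> N"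
proof -
  interpret directed_structures mu L I r M
    using mu ary dir Obj_K M le by unfold_locales (simp_all add: sub_le_def)
  \<comment> \<open>Regularity of \<open>theta\<close> keeps a small union of small universes
    small.\<close>
  have "|Univ U| <o theta"
    unfolding Univ_U using I M Obj_K by (intro stable_UNION regular_cardinalD(5)[OF theta]) auto
  then have U: "U \<in> Obj (Emb theta mu L)"
    using is_structure_U by (simp add: Emb_simps)
  have diaE: "is_diagram (Emb theta mu L) incl_diagram"
    using M Obj_K by (intro is_diagram_incl) blast
  have "is_diagram K incl_diagram"
    using diaE M le unfolding is_diagram_def
    by (simp add: Id_K Comp_K Emb_simps sub_le_def)
  then have "directed_diagram theta mu K incl_diagram"
    using I dir by (simp add: directed_diagram_def)
  moreover have "is_colimit (Emb theta mu L) incl_diagram U (\<lambda>i. \<lambda>x\<in>Univ (M i). x)"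
    using U is_substructure_U Univ_U by (rule is_colimit_union)
  ultimately have col: "is_colimit K incl_diagram U (\<lambda>i. \<lambda>x\<in>Univ (M i). x)"
    using closed unfolding closed_under_directed_colimits_def by blast
  then show UK: "U \<in> Obj K"
    by (simp add: is_colimit_def is_cocone_def)
  show MU: "M i \<preceq> U" if "i \<in> I" for i
    using col that M[OF that] UK is_substructure_U[OF that]
    by (simp add: is_colimit_def is_cocone_def sub_le_def)
  fix N assume N: "N \<in> Obj K" and MN: "\<And>i. i \<in> I \<Longrightarrow> M i \<preceq> N"
  have "is_cocone K incl_diagram N (\<lambda>i. \<lambda>x\<in>Univ (M i). x)"
    using N MN Univ_mono by (simp add: is_cocone_def sub_le_def Comp_K compose_incl(2))
  \<comment> \<open>Here it matters that the union is a colimit in \<open>K\<close> and not merely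
    in \<open>Emb\<close>: the induced map is a morphism of \<open>K\<close>, and it fixes every
    point, so it is the inclusion.\<close>
  from colimit_induced[OF col this] have "\<exists>h\<in>Hom K U N.
      \<forall>i\<in>I. compose (Univ (M i)) h (\<lambda>x\<in>Univ (M i). x) = (\<lambda>x\<in>Univ (M i). x)"
    by (simp only: incl_diagram_simps Comp_K)
  then obtain h where h: "h \<in> Hom K U N"
    and hi: "\<forall>i\<in>I. compose (Univ (M i)) h (\<lambda>x\<in>Univ (M i). x) = (\<lambda>x\<in>Univ (M i). x)"
    by blast
  have "h x = x" if x: "x \<in> Univ U" for x
  proof -
    obtain i where i: "i \<in> I" "x \<in> Univ (M i)"
      using x by (auto simp: Univ_U)
    show ?thesis
      using fun_cong[OF bspec[OF hi i(1)], of x] i(2) by (simp add: compose_def)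
  qed
  then have "h = (\<lambda>x\<in>Univ U. x)"
    using Hom_K[OF UK N h] by (auto simp: is_embedding_def PiE_iff extensional_def fun_eq_iff)
  then have hom: "(\<lambda>x\<in>Univ U. x) \<in> Hom K U N"
    using h by simp
  have "Univ U \<subseteq> Univ N"
    using MN by (auto simp: Univ_U sub_le_def is_substructure_def)
  then show "U \<preceq> N"
    using hom UK N Hom_K[OF UK N hom] by (simp add: sub_le_def is_substructure_def)
qed

lemma tarski_vaught_axiom: "tarski_vaught_axiom theta mu L (Obj K) (sub_le K mu L)"
  unfolding tarski_vaught_axiom_def
proof (intro allI impI, elim conjE)
  fix I :: "'u set" and r M
  assume *: "|I| <o theta" "directed_poset mu I r" "\<forall>i\<in>I. M i \<in> Obj K"
    "\<forall>i j. (i, j) \<in> r \<longrightarrow> M i \<preceq> M j"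
  show "union_struct mu L I M \<in> Obj K \<and> (\<forall>j\<in>I. M j \<preceq> union_struct mu L I M) \<and>
    (\<forall>N\<in>Obj K. (\<forall>i\<in>I. M i \<preceq> N) \<longrightarrow> union_struct mu L I M \<preceq> N)"
    using tarski_vaught[of I r M] * by simp
qed

section \<open>The Loewenheim-Skolem-Tarski axiom\<close>

text \<open>This trades morphisms for inclusions. The corestriction of \<open>c\<close> to its image
  is an isomorphism, hence in \<open>K\<close> together with its inverse, and the inclusion of the
  image is \<open>c\<close> after that inverse.\<close>

lemma image_le:
  assumes ob: "A \<in> Obj K" "M \<in> Obj K" and c: "c \<in> Hom K A M"
  defines "N \<equiv> sub_struct mu L M (c ` Univ A)"
  shows "N \<preceq> M" "c \<in> Hom K A N"
proof -
  have A: "is_structure mu L A" and emb: "is_embedding mu L A M c"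
    using Obj_K Hom_K ob c by blast+
  have cl: "closed_in mu L M (c ` Univ A)"
    using A emb by (rule closed_in_image)
  have N: "is_structure mu L N" "is_substructure mu L N M"
    unfolding N_def using cl by (rule is_structure_sub_struct, rule is_substructure_sub_struct)
  have iso: "is_isomorphism mu L A N c"
    unfolding N_def using A emb by (rule is_isomorphism_image)
  note NK = isomorphism_Obj_K[OF ob(1) N(1) iso]
  show "c \<in> Hom K A N"
    by (rule NK(2))
  obtain g where g: "is_isomorphism mu L N A g" and cg: "compose (Univ N) c g = (\<lambda>x\<in>Univ N. x)"
    using is_isomorphism_inverse[OF A N(1) iso] by metis
  have "g \<in> Hom K N A"
    using NK(1) A g by (rule isomorphism_Obj_K(2))
  from compose_Hom_K[OF NK(1) ob this c] have "(\<lambda>x\<in>Univ N. x) \<in> Hom K N M"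
    by (simp only: cg)
  then show "N \<preceq> M"
    using NK(1) ob(2) N(2) by (simp add: sub_le_def)
qed

text \<open>The \<open>N i\<close> are the images of the presentable objects of a diagram with colimit \<open>M\<close>.  Their
  union is all of \<open>M\<close> because it also carries a cocone over that diagram.\<close>

lemma exhaustion:
  assumes M: "M \<in> Obj K"
  shows "\<exists>(I :: 'u set) r N. |I| <o theta \<and> directed_poset mu I r \<and>
    (\<forall>i\<in>I. N i \<preceq> M \<and> |Univ (N i)| \<le>o |small_subsets mu (Field kappa)| ) \<and>
    (\<forall>i j. (i, j) \<in> r \<longrightarrow> N i \<preceq> N j) \<and> Univ M \<subseteq> (\<Union>i\<in>I. Univ (N i))"
proof -
  obtain \<A> where \<A>: "\<forall>A\<in>\<A>. presentable theta kappa K A"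
    and gen: "\<forall>X \<in> Obj K. \<exists>(D :: ('u, ('f, 'r, 'b, 'u) struct, 'u \<Rightarrow> 'u) diagram) c.
           directed_diagram theta kappa K D \<and> Ob D ` Idx D \<subseteq> \<A> \<and> is_colimit K D X c"
    using accessible unfolding accessible_def by blast
  obtain D :: "('u, ('f, 'r, 'b, 'u) struct, 'u \<Rightarrow> 'u) diagram" and c
    where D: "directed_diagram theta kappa K D" and DA: "Ob D ` Idx D \<subseteq> \<A>"
      and col: "is_colimit K D M c"
    using gen M by blast
  define I where "I = Idx D"
  define r where "r = Ord D"
  define N where "N = (\<lambda>i. sub_struct mu L M (c i ` Univ (Ob D i)))"
  have I: "|I| <o theta" and dirk: "directed_poset kappa I r" and dia: "is_diagram K D"
    using D by (simp_all add: directed_diagram_def I_def r_def)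
  have dir: "directed_poset mu I r"
    using dirk mu_kappa by (rule directed_poset_mono)
  note po = directed_posetD[OF dir mu]
  have ob: "Ob D i \<in> Obj K" if "i \<in> I" for i
    using dia that by (simp add: is_diagram_def I_def)
  have co: "is_cocone K D M c"
    using col by (simp add: is_colimit_def)
  have c: "c i \<in> Hom K (Ob D i) M" if "i \<in> I" for i
    using co that by (simp add: is_cocone_def I_def)
  have cij: "c i = compose (Univ (Ob D i)) (c j) (Ar D i j)" if "(i, j) \<in> r" for i j
    using co that by (simp add: is_cocone_def r_def Comp_K)
  have NM: "N i \<preceq> M" and cN: "c i \<in> Hom K (Ob D i) (N i)" if "i \<in> I" for i
    unfolding N_def using image_le[OF ob[OF that] M c[OF that]] by simp_all
  have NK: "N i \<in> Obj K" if "i \<in> I" for i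
    using NM[OF that] by (simp add: sub_le_def)
  \<comment> \<open>Both images lie below \<open>M\<close>, so by coherence only the containment of
    universes has to be checked; it follows from the cocone equation.\<close>
  have NN: "N i \<preceq> N j" if ij: "(i, j) \<in> r" for i j
  proof -
    have i: "i \<in> I" and j: "j \<in> I"
      using ij po(1) by auto
    have "Ar D i j \<in> Hom K (Ob D i) (Ob D j)"
      using dia ij by (simp add: is_diagram_def r_def)
    then have "Ar D i j ` Univ (Ob D i) \<subseteq> Univ (Ob D j)"
      using Hom_K[OF ob[OF i] ob[OF j], of "Ar D i j"] by (auto simp: is_embedding_def)
    moreover have "c i x = c j (Ar D i j x)" if "x \<in> Univ (Ob D i)" for x
      using fun_cong[OF cij[OF ij], of x] that by (simp add: compose_def)
    ultimately have "Univ (N i) \<subseteq> Univ (N j)"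
      by (auto simp: N_def)
    then show ?thesis
      by (rule le_cancel[OF NM[OF i] NM[OF j]])
  qed
  let ?U = "union_struct mu L I N"
  note TV = tarski_vaught[where M = N, OF I dir NK NN]
  have UK: "?U \<in> Obj K" and NU: "\<And>i. i \<in> I \<Longrightarrow> N i \<preceq> ?U"
    using TV(1,2) by blast+
  have UM: "?U \<preceq> M"
    using TV(3)[OF _ _ M NM] by blast
  have "is_cocone K D ?U c"
    unfolding is_cocone_def
  proof (intro conjI ballI allI impI)
    show "c i \<in> Hom K (Ob D i) ?U" if "i \<in> Idx D" for i
    proof -
      have i: "i \<in> I"
        using that by (simp add: I_def)
      have hom: "(\<lambda>x\<in>Univ (N i). x) \<in> Hom K (N i) ?U"
        using NU[OF i] by (simp add: sub_le_def)
      have "c i \<in> Univ (Ob D i) \<rightarrow>\<^sub>E Univ (N i)"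
        using Hom_K[OF ob[OF i] NK[OF i] cN[OF i]] by (simp add: is_embedding_def)
      then have "compose (Univ (Ob D i)) (\<lambda>x\<in>Univ (N i). x) (c i) = c i"
        by (auto simp: compose_def PiE_iff extensional_def fun_eq_iff)
      then show ?thesis
        using compose_Hom_K[OF ob[OF i] NK[OF i] UK cN[OF i] hom] by simp
    qed
    show "c i = Comp K (Ob D i) (Ob D j) ?U (c j) (Ar D i j)" if "(i, j) \<in> Ord D" for i j
      using cij that by (simp add: r_def Comp_K)
  qed (rule UK)
  moreover have "(\<lambda>x\<in>Univ ?U. x) \<in> Hom K ?U M"
    using UM by (simp add: sub_le_def)
  moreover have "Comp K (Ob D i) ?U M (\<lambda>x\<in>Univ ?U. x) (c i) = c i" if "i \<in> Idx D" for i
  proof -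
    have "i \<in> I"
      using that by (simp add: I_def)
    then have "c i \<in> extensional (Univ (Ob D i))" "c i ` Univ (Ob D i) \<subseteq> Univ ?U"
      using Hom_K[OF ob M c] by (auto simp: is_embedding_def PiE_iff union_struct_def N_def)
    then show ?thesis
      by (auto simp: Comp_K compose_def extensional_def fun_eq_iff)
  qed
  ultimately obtain h where h: "h \<in> Hom K M ?U" and "Comp K M ?U M (\<lambda>x\<in>Univ ?U. x) h = Id K M"
    using colimit_section[OF is_category_K dia col] by blast
  then have eq: "compose (Univ M) (\<lambda>x\<in>Univ ?U. x) h = (\<lambda>x\<in>Univ M. x)"
    by (simp add: Comp_K Id_K)
  have "Univ M \<subseteq> Univ ?U"
  proof
    fix x assume x: "x \<in> Univ M"
    then have "h x \<in> Univ ?U"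
      using Hom_K[OF M UK h] by (auto simp: is_embedding_def)
    then show "x \<in> Univ ?U"
      using fun_cong[OF eq, of x] x by (simp add: compose_def)
  qed
  then have "Univ M \<subseteq> (\<Union>i\<in>I. Univ (N i))"
    by (simp add: union_struct_def)
  moreover have "|Univ (N i)| \<le>o |small_subsets mu (Field kappa)|" if i: "i \<in> I" for i
  proof -
    have "presentable theta kappa (Emb theta mu L) (Ob D i)"
      using presentable \<A> DA i by (auto simp: I_def)
    then have "|Univ (Ob D i)| \<le>o |small_subsets mu (Field kappa)|"
      using univ mu ary kappa mu_kappa L_kappa by (intro presentable_Emb_card)
    then show ?thesis
      unfolding N_def Univ_sub_struct using card_of_image by (rule ordLeq_transitive[rotated])
  qed
  ultimately show ?thesis
    using I dir NM NN by (intro exI[of _ I] exI[of _ r] exI[of _ N]) simp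
qed

lemma loewenheim_skolem:
  assumes M: "M \<in> Obj K" and A: "A \<subseteq> Univ M"
  shows "\<exists>N. N \<preceq> M \<and> A \<subseteq> Univ N \<and> |Univ N| \<le>o |small_subsets mu (A <+> Field kappa)|"
proof -
  \<comment> \<open>The disjoint sum dominates both \<open>A\<close> and \<open>kappa\<close>. So
    \<open>mu\<close> lies below it and idempotence is available even when \<open>A\<close> itself
    is smaller than \<open>mu\<close>.\<close>
  define C where "C = small_subsets mu (A <+> Field kappa)"
  have F: "|Field kappa| \<le>o |A <+> Field kappa|"
    by (rule card_of_Plus2)
  have kF: "kappa =o |Field kappa|"
    using card_of_Field_ordIso[OF regular_cardinalD(1)[OF kappa]] by (rule ordIso_symmetric)
  have muP: "mu \<le>o |A <+> Field kappa|"
    using ordLeq_transitive[OF ordLeq_ordIso_trans[OF mu_kappa kF] F] .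
  have PC: "|A <+> Field kappa| \<le>o |C|"
    unfolding C_def by (rule card_le_small_subsets[OF mu])
  have C: "|small_subsets mu C| \<le>o |C|" "mu \<le>o |C|"
    using small_subsets_idem[OF mu muP] ordLeq_transitive[OF muP PC] by (simp_all add: C_def)
  have inf: "\<not> finite C"
    using regular_cardinalD(3)[OF mu] cinfinite_mono[OF C(2)] by (simp add: cinfinite_def Field_card_of)
  have AC: "|A| \<le>o |C|"
    using ordLeq_transitive[OF card_of_Plus1 PC] .
  obtain I :: "'u set" and r and N :: "'u \<Rightarrow> ('f, 'r, 'b, 'u) struct"
    where I: "|I| <o theta" and dir: "directed_poset mu I r" and NM: "\<And>i. i \<in> I \<Longrightarrow> N i \<preceq> M"
      and NN: "\<And>i j. (i, j) \<in> r \<Longrightarrow> N i \<preceq> N j" and cover: "Univ M \<subseteq> (\<Union>i\<in>I. Univ (N i))"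
      and card: "\<And>i. i \<in> I \<Longrightarrow> |Univ (N i)| \<le>o |small_subsets mu (Field kappa)|"
    using exhaustion[OF M] by auto
  have "\<forall>x\<in>A. \<exists>i. i \<in> I \<and> x \<in> Univ (N i)"
    using A cover by blast
  then obtain s where s: "\<And>x. x \<in> A \<Longrightarrow> s x \<in> I \<and> x \<in> Univ (N (s x))"
    by metis
  have "\<forall>Y. \<exists>u. Y \<subseteq> I \<and> |Y| <o mu \<longrightarrow> u \<in> I \<and> (\<forall>x\<in>Y. (x, u) \<in> r)"
    using dir unfolding directed_poset_def by blast
  then obtain b where b: "\<And>Y. Y \<subseteq> I \<Longrightarrow> |Y| <o mu \<Longrightarrow> b Y \<in> I \<and> (\<forall>x\<in>Y. (x, b Y) \<in> r)"
    by metis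
  \<comment> \<open>The empty set counts as a small \<open>Y\<close>, so \<open>b {}\<close> lies in
    \<open>J\<close>. Hence \<open>J\<close> is nonempty, as directedness requires, even if
    \<open>A\<close> is empty.\<close>
  define J where "J = closed_op mu (\<lambda>Y. {b Y}) hull (s ` A)"
  have "closed_op mu (\<lambda>Y. {b Y}) I"
    using b by (auto simp: closed_op_def)
  then have JI: "J \<subseteq> I"
    unfolding J_def using s by (intro hull_minimal) auto
  have sJ: "s ` A \<subseteq> J"
    unfolding J_def by (rule hull_subset)
  have bJ: "b Y \<in> J" if "Y \<subseteq> J" "|Y| <o mu" for Y
    using closed_op_hull[of mu "\<lambda>Y. {b Y}" "s ` A"] that by (simp add: closed_op_def J_def)
  have JC: "|J| \<le>o |C|"
    unfolding J_def
  proof (rule card_closed_op_hull[OF mu C])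
    show "|{b Y}| \<le>o |C|" for Y
      using inf by (intro card_of_singl_ordLeq) auto
    show "|s ` A| \<le>o |C|"
      using ordLeq_transitive[OF card_of_image AC] .
  qed
  have dirJ: "directed_poset mu J (Restr r J)"
    unfolding directed_poset_def
  proof (intro conjI allI impI)
    have "partial_order_on I r"
      using dir by (simp add: directed_poset_def)
    then show "partial_order_on J (Restr r J)"
      using JI unfolding partial_order_on_def preorder_on_def
      by (auto simp: refl_on_def trans_Restr antisym_Restr)
    fix Y assume Y: "Y \<subseteq> J \<and> |Y| <o mu"
    have "\<forall>x\<in>Y. (x, b Y) \<in> r"
      using Y b[of Y] JI by blast
    then show "\<exists>u\<in>J. \<forall>x\<in>Y. (x, u) \<in> Restr r J"
      using bJ[of Y] Y by blast
  qed
  have J: "|J| <o theta"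
    using ordLeq_ordLess_trans[OF card_of_mono1[OF JI] I] .
  have NK: "N i \<in> Obj K" if "i \<in> J" for i
    using NM[of i] that JI by (auto simp: sub_le_def)
  have NNJ: "N i \<preceq> N j" if "(i, j) \<in> Restr r J" for i j
    using NN that by simp
  let ?U = "union_struct mu L J N"
  have "?U \<preceq> M"
    using tarski_vaught(3)[where M = N, OF J dirJ NK NNJ M] NM JI by blast
  moreover have "A \<subseteq> Univ ?U"
    using s sJ by (auto simp: union_struct_def)
  moreover have "|Univ ?U| \<le>o |C|"
  proof -
    have "|Univ (N i)| \<le>o |C|" if "i \<in> J" for i
      using ordLeq_transitive[OF card small_subsets_mono_card[OF F, of mu]] that JI
      by (auto simp: C_def)
    then show ?thesis
      using inf JC by (simp add: union_struct_def card_of_UNION_ordLeq_infinite)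
  qed
  ultimately show ?thesis
    unfolding C_def by blast
qed

lemma kappa_le_small_subsets: "kappa \<le>o |small_subsets mu (Field kappa)|"
  using ordIso_ordLeq_trans[OF ordIso_symmetric[OF card_of_Field_ordIso[OF regular_cardinalD(1)[OF kappa]]]
      card_le_small_subsets[OF mu]] .

text \<open>The witness is \<open>kappa^{<mu}\<close>, counted by small subsets of
  \<open>Field kappa\<close> and copied to a set \<open>\<Lambda>\<close> of elements of
  \<open>'u\<close>, where \<open>LST_witness\<close> expects it. The required
  \<open>lam^{<mu} = lam\<close> is the idempotence of small subsets.\<close>

lemma LST_witness_exists:
  "\<exists>lam. LST_witness theta mu L (Obj K) (sub_le K mu L) lam \<and> lam \<le>o less_power (Field kappa) mu"
proof -
  let ?C = "small_subsets mu (Field kappa)"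
  have kF: "|Field kappa| =o kappa"
    by (rule card_of_Field_ordIso[OF regular_cardinalD(1)[OF kappa]])
  have muF: "mu \<le>o |Field kappa|"
    using ordLeq_ordIso_trans[OF mu_kappa ordIso_symmetric[OF kF]] .
  have "kappa <o theta"
    using univ by (simp add: universe_def)
  then have "|Field kappa| <o theta"
    using kF by (rule ordIso_ordLess_trans[rotated])
  then obtain B :: "'u set" where B: "|Field kappa| =o |B|" "|B| <o theta"
    using internalize_card_of_ordLess[of "Field kappa" theta] by blast
  have "|?C| \<le>o |small_subsets mu B|"
    using B(1) by (intro small_subsets_mono_card) (rule ordIso_imp_ordLeq)
  \<comment> \<open>\<open>universe\<close> bounds sets of subsets of size \<open>< kappa\<close>;
    those of size \<open>< mu\<close> are among them.\<close>
  moreover have "small_subsets mu B \<subseteq> small_subsets kappa B"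
    using mu_kappa by (auto simp: small_subsets_def intro: ordLess_ordLeq_trans)
  moreover have "|small_subsets kappa B| <o theta"
    using univ B(2) by (simp add: universe_def small_subsets_def)
  ultimately have "|?C| <o theta"
    by (meson card_of_mono1 ordLeq_ordLess_trans)
  then obtain \<Lambda> :: "'u set" where \<Lambda>: "|?C| =o |\<Lambda>|" "|\<Lambda>| <o theta"
    using internalize_card_of_ordLess[of ?C theta] by blast
  have \<Lambda>C: "|\<Lambda>| \<le>o |?C|" and C\<Lambda>: "|?C| \<le>o |\<Lambda>|"
    using \<Lambda>(1) by (simp_all add: ordIso_iff_ordLeq)
  have idem: "less_power \<Lambda> mu =o |\<Lambda>|"
    unfolding ordIso_iff_ordLeq
  proof
    show "less_power \<Lambda> mu \<le>o |\<Lambda>|"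
      using less_power_mono_card[OF \<Lambda>C] less_power_small_subsets[OF mu muF] C\<Lambda>
      by (meson ordLeq_transitive)
    show "|\<Lambda>| \<le>o less_power \<Lambda> mu"
      using card_le_small_subsets[OF mu] small_subsets_le_less_power[OF mu]
      by (rule ordLeq_transitive)
  qed
  have "LST_witness theta mu L (Obj K) (sub_le K mu L) |\<Lambda>|"
    unfolding LST_witness_def Field_card_of
  proof (intro conjI ballI allI impI)
    have "sig_card L +c mu =o mu +c sig_card L"
      by (rule csum_com)
    also have "mu +c sig_card L \<le>o kappa"
      by (rule mu_L_kappa)
    also have "kappa \<le>o |?C|"
      by (rule kappa_le_small_subsets)
    finally show "sig_card L +c mu \<le>o |\<Lambda>|"
      using C\<Lambda> by (rule ordLeq_transitive)
    fix M A assume "M \<in> Obj K" "A \<subseteq> Univ M"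
    then obtain N where N: "N \<preceq> M" "A \<subseteq> Univ N" "|Univ N| \<le>o |small_subsets mu (A <+> Field kappa)|"
      using loewenheim_skolem by blast
    have "|small_subsets mu (A <+> Field kappa)| \<le>o |small_subsets mu A| +c |?C|"
      using card_small_subsets_Plus[OF mu muF] .
    moreover have "|small_subsets mu A| +c |?C| \<le>o less_power A mu +c |\<Lambda>|"
      using small_subsets_le_less_power[OF mu] C\<Lambda> by (rule csum_mono)
    ultimately show "\<exists>N. N \<preceq> M \<and> A \<subseteq> Univ N \<and> |Univ N| \<le>o less_power A mu +c |\<Lambda>|"
      using N by (meson ordLeq_transitive)
  qed (simp_all add: \<Lambda>(2) idem card_of_card_order_on)
  moreover have "|\<Lambda>| \<le>o less_power (Field kappa) mu"
    using \<Lambda>C small_subsets_le_less_power[OF mu] by (rule ordLeq_transitive)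
  ultimately show ?thesis
    by blast
qed

end

text \<open>A nonempty set of well-orders on one type has a \<open>\<le>o\<close>-least member, so
  the choice in \<open>LS_number\<close> really picks a least witness.\<close>

lemma LS_number_least:
  fixes le :: "('f, 'r, 'b, 'u) struct \<Rightarrow> ('f, 'r, 'b, 'u) struct \<Rightarrow> bool"
  assumes "LST_witness theta mu L \<K> le lam"
  shows "LS_number theta mu L \<K> le \<le>o lam"
proof -
  let ?W = "Collect (LST_witness theta mu L \<K> le)"
  have "\<exists>r\<in>?W. \<forall>r'\<in>?W. r \<le>o r'"
  proof (rule exists_minim_Well_order)
    show "?W \<noteq> {}"
      using assms by blast
    show "\<forall>r\<in>?W. Well_order r"
      by (simp add: LST_witness_def card_order_on_well_order_on)
  qed
  then have "\<exists>r. LST_witness theta mu L \<K> le r \<and> (\<forall>r'. LST_witness theta mu L \<K> le r' \<longrightarrow> r \<le>o r')"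
    by blast
  from someI_ex[OF this] show ?thesis
    using assms unfolding LS_number_def by blast
qed

theorem theorem4p5:
  fixes theta :: "'u rel" and mu :: "'b rel" and kappa :: "'k rel"
    and L :: "('f, 'r, 'b) signature"
    and K :: "(('f, 'r, 'b, 'u) struct, 'u \<Rightarrow> 'u) category"
  assumes "universe theta kappa"
    and "regular_cardinal mu" and "mu_ary mu L"
    and "regular_cardinal kappa" and "mu +c sig_card L \<le>o kappa"
    and "subcategory K (Emb theta mu L)"
    and "iso_full K (Emb theta mu L)"
    and "replete K (Emb theta mu L)"
    and "coherent K (Emb theta mu L)"
    and "accessible theta kappa K"
    and "closed_under_directed_colimits theta mu K (Emb theta mu L)"
    and "\<forall>M. presentable theta kappa K M \<longrightarrow> presentable theta kappa (Emb theta mu L) M"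
  shows "mu_AEC theta mu L (Obj K) (sub_le K mu L) \<and>
    LS_number theta mu L (Obj K) (sub_le K mu L) \<le>o less_power (Field kappa) mu"
proof -
  interpret embedding_subcategory theta mu kappa L K
    by unfold_locales (fact assms)+
  obtain lam where lam: "LST_witness theta mu L (Obj K) (sub_le K mu L) lam"
    "lam \<le>o less_power (Field kappa) mu"
    using LST_witness_exists by blast
  have "mu_AEC theta mu L (Obj K) (sub_le K mu L)"
    unfolding mu_AEC_def
    using mu abstract_class coherence_axiom tarski_vaught_axiom lam(1) by blast
  moreover have "LS_number theta mu L (Obj K) (sub_le K mu L) \<le>o less_power (Field kappa) mu"
    using LS_number_least[OF lam(1)] lam(2) by (rule ordLeq_transitive)
  ultimately show ?thesis
    by blast
qed

end
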